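(* Let $P\colon\mathcal C^{op}\to\mathbf{InfSL}$ be an existential doctrine. Then $(P,(\mathrm{id}_{\mathcal C},\zeta_P))$ is a $T_e$-algebra, where $(\mathrm{id}_{\mathcal C},\zeta_P)\colon P^e\to P$ is the 1-cell of existential doctrines whose component $(\zeta_P)_A\colon P^e(A)\to P(A)$ sends $(f\colon C\to A,\ \alpha)$ to $\exists_f(\alpha)$.
   Context: An inf-semilattice is a poset with finite meets (including a top element $\top$); $\mathbf{InfSL}$ is the category of inf-semilattices and finite-meet-preserving maps. No size distinctions are made between categories and fibres. A primary doctrine is a functor $P\colon \mathcal C^{op}\to\mathbf{InfSL}$ with $\mathcal C$ a category with finite products; for $f\colon A\to B$ write $P_f\colon P(B)\to P(A)$ for its action. A morphism $X\to A$ is called a projection if it is one of the legs of a binary product diagram $A\leftarrow X\to B$ for some object $B$. A primary doctrine $P$ is existential if for every projection $\mathrm{pr}\colon X\to A$ the map $P_{\mathrm{pr}}$ has a left adjoint $\exists_{\mathrm{pr}}$ and these satisfy: (Beck-Chevalley) for any pullback square $f\,\mathrm{pr}'=\mathrm{pr} f'$ with $\mathrm{pr}\colon X\to A$, $\mathrm{pr}'\colon X'\to A'$ projections, $\exists_{\mathrm{pr}'}P_{f'}(\beta)=P_f\exists_{\mathrm{pr}}(\beta)$ for all $\beta\in P(X)$; (Frobenius) $\exists_{\mathrm{pr}}(P_{\mathrm{pr}}(\alpha)\wedge\beta)=\alpha\wedge\exists_{\mathrm{pr}}(\beta)$ for all $\alpha\in P(A)$, $\beta\in P(X)$. The 2-category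 $\mathbf{PD}$: 0-cells are primary doctrines; 1-cells from $P\colon\mathcal C^{op}\to\mathbf{InfSL}$ to $R\colon\mathcal D^{op}\to\mathbf{InfSL}$ are pairs $(F,b)$ with $F\colon\mathcal C\to\mathcal D$ a finite-product-preserving functor and $b\colon P\to R\circ F^{op}$ a natural transformation whose components preserve finite meets; 2-cells $(F,b)\Rightarrow(G,c)$ are natural transformations $\theta\colon F\to G$ with $b_A(\alpha)\le R_{\theta_A}(c_A(\alpha))$ for all $A$, $\alpha\in P(A)$. A 1-cell of existential doctrines is a 1-cell $(F,b)$ of $\mathbf{PD}$ between existential doctrines with $b_A\exists_g=\exists_{Fg}b_C$ for each projection $g\colon C\to A$. Existential completion: $P^e(A)$ is the poset reflection of the preorder of pairs $(g\colon B\to A,\ \alpha\in P(B))$ with $g$ a projection, where $(h\colon B\to A,\alpha)\le(f\colon D\to A,\gamma)$ iff there is $w\colon B\to D$ with $fw=h$ and $\alpha\le P_w(\gamma)$; for $f\colon A\to B$, $P^e_f(g\colon C\to B,\beta)=(f^*g,\ P_{g^*f}(\beta))$, with $f^*g\colon D\to A$, $g^*f\colon D\to C$ a pullback of $g$ along $f$. $P^e$ is an existential doctrine, with left adjoints along projections $\exists^e_f(h,\alpha)=(fh,\alpha)$. The 2-monad $(T_e,\mu,\eta)$ on $\mathbf{PD}$: $T_e(P)=P^e$; $T_e(F,b)=(F,b^e)$ with $b^e_A(g\colon C\to A,\alpha)=(Fg\colon FC\to FA,b_C(\alpha))$; $T_e(\theta)=\theta$; $\eta_P=(\mathrm{id}_{\mathcal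 C},\iota_P)\colon P\to P^e$ with $(\iota_P)_A(\alpha)=(\mathrm{id}_A,\alpha)$; $\mu_P=(\mathrm{id}_{\mathcal C},\zeta_{P^e})\colon (P^e)^e\to P^e$, where $(\zeta_{P^e})_A(f\colon C\to A,\overline\alpha)=\exists^e_f(\overline\alpha)$. For a 2-monad $(T,\mu,\eta)$, a $T$-algebra is a pair $(A,a)$ with $a\colon TA\to A$ a 1-cell such that $a\cdot Ta=a\cdot\mu_A$ and $a\cdot\eta_A=1_A$ (strict equalities). *)

theory Defs
  imports "HOL-Algebra.Galois_Connection"
begin

section \<open>Inf-semilattices\<close>

locale inf_semilattice = lower_semilattice L + weak_partial_order_top L for L (structure)

definition meet_map :: "'a gorder \<Rightarrow> 'b gorder \<Rightarrow> ('a \<Rightarrow> 'b) \<Rightarrow> bool" where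
  "meet_map L M h \<longleftrightarrow>
     h \<in> carrier L \<rightarrow> carrier M \<and>
     h \<top>\<^bsub>L\<^esub> = \<top>\<^bsub>M\<^esub> \<and>
     (\<forall>x\<in>carrier L. \<forall>y\<in>carrier L. h (x \<sqinter>\<^bsub>L\<^esub> y) = h x \<sqinter>\<^bsub>M\<^esub> h y)"


section \<open>Categories with finite products\<close>

record ('o, 'm) cat =
  obj :: "'o set"
  arr :: "'m set"
  src :: "'m \<Rightarrow> 'o"
  tgt :: "'m \<Rightarrow> 'o"
  ident :: "'o \<Rightarrow> 'm"
  cmp :: "'m \<Rightarrow> 'm \<Rightarrow> 'm" (infixr \<open>\<cdot>\<index>\<close> 75)

text \<open>Composition is written in the applicative order: \<open>g \<cdot> f\<close> is \<open>f\<close> followed by \<open>g\<close>.\<close>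

definition Hom :: "('o, 'm) cat \<Rightarrow> 'o \<Rightarrow> 'o \<Rightarrow> 'm set" where
  "Hom C A B = {f \<in> arr C. src C f = A \<and> tgt C f = B}"

locale category =
  fixes C :: "('o, 'm) cat" (structure)
  assumes src_obj: "f \<in> arr C \<Longrightarrow> src C f \<in> obj C"
    and tgt_obj: "f \<in> arr C \<Longrightarrow> tgt C f \<in> obj C"
    and ident_hom: "A \<in> obj C \<Longrightarrow> ident C A \<in> Hom C A A"
    and cmp_hom: "\<lbrakk>f \<in> Hom C A B; g \<in> Hom C B D\<rbrakk> \<Longrightarrow> g \<cdot> f \<in> Hom C A D"
    and cmp_ident_left: "f \<in> Hom C A B \<Longrightarrow> ident C B \<cdot> f = f"
    and cmp_ident_right: "f \<in> Hom C A B \<Longrightarrow> f \<cdot> ident C A = f"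
    and cmp_assoc: "\<lbrakk>f \<in> Hom C A B; g \<in> Hom C B D; h \<in> Hom C D E\<rbrakk>
      \<Longrightarrow> (h \<cdot> g) \<cdot> f = h \<cdot> (g \<cdot> f)"

definition is_terminal :: "('o, 'm) cat \<Rightarrow> 'o \<Rightarrow> bool" where
  "is_terminal C t \<longleftrightarrow> t \<in> obj C \<and> (\<forall>A\<in>obj C. \<exists>!f. f \<in> Hom C A t)"

definition is_product :: "('o, 'm) cat \<Rightarrow> 'm \<Rightarrow> 'm \<Rightarrow> bool" where
  "is_product C p q \<longleftrightarrow>
     p \<in> arr C \<and> q \<in> arr C \<and> src C p = src C q \<and>
     (\<forall>X\<in>obj C. \<forall>f\<in>Hom C X (tgt C p). \<forall>g\<in>Hom C X (tgt C q).
        \<exists>!u. u \<in> Hom C X (src C p) \<and> p \<cdot>\<^bsub>C\<^esub> u = f \<and> q \<cdot>\<^bsub>C\<^esub> u = g)"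

definition projection :: "('o, 'm) cat \<Rightarrow> 'm \<Rightarrow> bool" where
  "projection C f \<longleftrightarrow> (\<exists>q. is_product C f q \<or> is_product C q f)"

text \<open>\<open>is_pullback C f g p q\<close>: the pair \<open>p, q\<close> is a pullback of \<open>f, g\<close>, where \<open>f \<cdot> p = g \<cdot> q\<close>;
  so \<open>p\<close> is the pullback of \<open>g\<close> along \<open>f\<close>.\<close>

definition is_pullback :: "('o, 'm) cat \<Rightarrow> 'm \<Rightarrow> 'm \<Rightarrow> 'm \<Rightarrow> 'm \<Rightarrow> bool" where
  "is_pullback C f g p q \<longleftrightarrow>
     f \<in> arr C \<and> g \<in> arr C \<and> tgt C f = tgt C g \<and>
     p \<in> arr C \<and> q \<in> arr C \<and> src C p = src C q \<and>
     tgt C p = src C f \<and> tgt C q = src C g \<and> f \<cdot>\<^bsub>C\<^esub> p = g \<cdot>\<^bsub>C\<^esub> q \<and>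
     (\<forall>X\<in>obj C. \<forall>h\<in>Hom C X (src C f). \<forall>k\<in>Hom C X (src C g). f \<cdot>\<^bsub>C\<^esub> h = g \<cdot>\<^bsub>C\<^esub> k \<longrightarrow>
        (\<exists>!u. u \<in> Hom C X (src C p) \<and> p \<cdot>\<^bsub>C\<^esub> u = h \<and> q \<cdot>\<^bsub>C\<^esub> u = k))"

locale fp_category = category +
  assumes terminal_exists: "\<exists>t. is_terminal C t"
    and product_exists: "\<lbrakk>A \<in> obj C; B \<in> obj C\<rbrakk>
      \<Longrightarrow> \<exists>p q. is_product C p q \<and> tgt C p = A \<and> tgt C q = B"

text \<open>The maps of functors, and below the components of natural transformations, are required to be
  \<^const>\<open>extensional\<close>, so that strict equality of 1-cells is equality in HOL.\<close>

record ('o, 'm, 'p, 'n) ftor =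
  on_obj :: "'o \<Rightarrow> 'p"
  on_arr :: "'m \<Rightarrow> 'n"

locale fp_functor = source: fp_category C + target: fp_category D
  for C :: "('o, 'm) cat" and D :: "('p, 'n) cat" and F :: "('o, 'm, 'p, 'n) ftor" +
  assumes on_obj_extensional: "on_obj F \<in> extensional (obj C)"
    and on_arr_extensional: "on_arr F \<in> extensional (arr C)"
    and on_obj_closed: "A \<in> obj C \<Longrightarrow> on_obj F A \<in> obj D"
    and on_arr_hom: "f \<in> Hom C A B \<Longrightarrow> on_arr F f \<in> Hom D (on_obj F A) (on_obj F B)"
    and preserves_ident: "A \<in> obj C \<Longrightarrow> on_arr F (ident C A) = ident D (on_obj F A)"
    and preserves_cmp: "\<lbrakk>f \<in> Hom C A B; g \<in> Hom C B E\<rbrakk>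
      \<Longrightarrow> on_arr F (g \<cdot>\<^bsub>C\<^esub> f) = on_arr F g \<cdot>\<^bsub>D\<^esub> on_arr F f"
    and preserves_terminal: "is_terminal C t \<Longrightarrow> is_terminal D (on_obj F t)"
    and preserves_product: "is_product C p q \<Longrightarrow> is_product D (on_arr F p) (on_arr F q)"

definition id_ftor :: "('o, 'm) cat \<Rightarrow> ('o, 'm, 'o, 'm) ftor" where
  "id_ftor C = \<lparr>on_obj = (\<lambda>A\<in>obj C. A), on_arr = (\<lambda>f\<in>arr C. f)\<rparr>"

definition comp_ftor ::
  "('o, 'm) cat \<Rightarrow> ('p, 'n, 'r, 'l) ftor \<Rightarrow> ('o, 'm, 'p, 'n) ftor \<Rightarrow> ('o, 'm, 'r, 'l) ftor" where
  "comp_ftor C G F =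
     \<lparr>on_obj = compose (obj C) (on_obj G) (on_obj F),
      on_arr = compose (arr C) (on_arr G) (on_arr F)\<rparr>"


section \<open>Primary and existential doctrines\<close>

record ('o, 'm, 'a) doctrine =
  base :: "('o, 'm) cat"
  fib :: "'o \<Rightarrow> 'a gorder"
  reidx :: "'m \<Rightarrow> 'a \<Rightarrow> 'a"

locale primary_doctrine =
  fixes P :: "('o, 'm, 'a) doctrine"
  assumes base_fp: "fp_category (base P)"
    and fib_inf_semilattice: "A \<in> obj (base P) \<Longrightarrow> inf_semilattice (fib P A)"
    and reidx_meet_map: "f \<in> Hom (base P) A B \<Longrightarrow> meet_map (fib P B) (fib P A) (reidx P f)"
    and reidx_ident: "\<lbrakk>A \<in> obj (base P); \<alpha> \<in> carrier (fib P A)\<rbrakk>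
      \<Longrightarrow> reidx P (ident (base P) A) \<alpha> = \<alpha>"
    and reidx_cmp: "\<lbrakk>f \<in> Hom (base P) A B; g \<in> Hom (base P) B D; \<alpha> \<in> carrier (fib P D)\<rbrakk>
      \<Longrightarrow> reidx P (g \<cdot>\<^bsub>base P\<^esub> f) \<alpha> = reidx P f (reidx P g \<alpha>)"

definition is_left_adjoint :: "('o, 'm, 'a) doctrine \<Rightarrow> 'm \<Rightarrow> ('a \<Rightarrow> 'a) \<Rightarrow> bool" where
  "is_left_adjoint P f e \<longleftrightarrow>
     galois_connection
       \<lparr>orderA = fib P (src (base P) f), orderB = fib P (tgt (base P) f),
        lower = e, upper = reidx P f\<rparr>"

definition ex :: "('o, 'm, 'a) doctrine \<Rightarrow> 'm \<Rightarrow> 'a \<Rightarrow> 'a" where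
  "ex P f = (THE e. e \<in> extensional (carrier (fib P (src (base P) f))) \<and> is_left_adjoint P f e)"

locale existential_doctrine = primary_doctrine +
  assumes left_adjoint_exists: "projection (base P) f \<Longrightarrow> \<exists>e. is_left_adjoint P f e"
    and beck_chevalley:
      "\<lbrakk>projection (base P) pr; projection (base P) pr'; is_pullback (base P) f pr pr' f';
        \<beta> \<in> carrier (fib P (src (base P) pr))\<rbrakk>
      \<Longrightarrow> ex P pr' (reidx P f' \<beta>) = reidx P f (ex P pr \<beta>)"
    and frobenius:
      "\<lbrakk>projection (base P) pr; \<alpha> \<in> carrier (fib P (tgt (base P) pr));
        \<beta> \<in> carrier (fib P (src (base P) pr))\<rbrakk>
      \<Longrightarrow> ex P pr (reidx P pr \<alpha> \<sqinter>\<^bsub>fib P (src (base P) pr)\<^esub> \<beta>)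
          = \<alpha> \<sqinter>\<^bsub>fib P (tgt (base P) pr)\<^esub> ex P pr \<beta>"


section \<open>1-cells\<close>

type_synonym ('o, 'm, 'a, 'p, 'n, 'b) cell = "('o, 'm, 'p, 'n) ftor \<times> ('o \<Rightarrow> 'a \<Rightarrow> 'b)"

definition pd_cell ::
  "('o, 'm, 'a) doctrine \<Rightarrow> ('p, 'n, 'b) doctrine \<Rightarrow> ('o, 'm, 'a, 'p, 'n, 'b) cell \<Rightarrow> bool" where
  "pd_cell P R = (\<lambda>(F, b).
     primary_doctrine P \<and> primary_doctrine R \<and> fp_functor (base P) (base R) F \<and>
     b \<in> extensional (obj (base P)) \<and>
     (\<forall>A\<in>obj (base P). b A \<in> extensional (carrier (fib P A)) \<and>
        meet_map (fib P A) (fib R (on_obj F A)) (b A)) \<and>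
     (\<forall>A\<in>obj (base P). \<forall>B\<in>obj (base P). \<forall>f\<in>Hom (base P) A B. \<forall>\<alpha>\<in>carrier (fib P B).
        b A (reidx P f \<alpha>) = reidx R (on_arr F f) (b B \<alpha>)))"

definition ed_cell ::
  "('o, 'm, 'a) doctrine \<Rightarrow> ('p, 'n, 'b) doctrine \<Rightarrow> ('o, 'm, 'a, 'p, 'n, 'b) cell \<Rightarrow> bool" where
  "ed_cell P R = (\<lambda>(F, b).
     existential_doctrine P \<and> existential_doctrine R \<and> pd_cell P R (F, b) \<and>
     (\<forall>g. projection (base P) g \<longrightarrow>
        (\<forall>\<alpha>\<in>carrier (fib P (src (base P) g)).
           b (tgt (base P) g) (ex P g \<alpha>) = ex R (on_arr F g) (b (src (base P) g) \<alpha>))))"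

definition id_cell :: "('o, 'm, 'a) doctrine \<Rightarrow> ('o, 'm, 'a, 'o, 'm, 'a) cell" where
  "id_cell P = (id_ftor (base P), \<lambda>A\<in>obj (base P). \<lambda>\<alpha>\<in>carrier (fib P A). \<alpha>)"

text \<open>\<open>comp_cell P d c\<close> is the composite \<open>d \<cdot> c\<close>; \<open>P\<close> is the source of \<open>c\<close>.\<close>

definition comp_cell ::
  "('o, 'm, 'a) doctrine \<Rightarrow> ('p, 'n, 'b, 'r, 'l, 'c) cell \<Rightarrow> ('o, 'm, 'a, 'p, 'n, 'b) cell
    \<Rightarrow> ('o, 'm, 'a, 'r, 'l, 'c) cell" where
  "comp_cell P = (\<lambda>(G, c) (F, b).
     (comp_ftor (base P) G F,
      \<lambda>A\<in>obj (base P). compose (carrier (fib P A)) (c (on_obj F A)) (b A)))"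


section \<open>The existential completion\<close>

definition ext_pairs :: "('o, 'm, 'a) doctrine \<Rightarrow> 'o \<Rightarrow> ('m \<times> 'a) set" where
  "ext_pairs P A =
     {(g, \<alpha>). projection (base P) g \<and> tgt (base P) g = A \<and> \<alpha> \<in> carrier (fib P (src (base P) g))}"

definition ext_le :: "('o, 'm, 'a) doctrine \<Rightarrow> 'm \<times> 'a \<Rightarrow> 'm \<times> 'a \<Rightarrow> bool" where
  "ext_le P = (\<lambda>(h, \<alpha>) (f, \<gamma>).
     \<exists>w\<in>Hom (base P) (src (base P) h) (src (base P) f).
       f \<cdot>\<^bsub>base P\<^esub> w = h \<and> \<alpha> \<sqsubseteq>\<^bsub>fib P (src (base P) h)\<^esub> reidx P w \<gamma>)"

definition ext_rel :: "('o, 'm, 'a) doctrine \<Rightarrow> 'o \<Rightarrow> (('m \<times> 'a) \<times> ('m \<times> 'a)) set" where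
  "ext_rel P A =
     {(x, y). x \<in> ext_pairs P A \<and> y \<in> ext_pairs P A \<and> ext_le P x y \<and> ext_le P y x}"

definition ext_class :: "('o, 'm, 'a) doctrine \<Rightarrow> 'm \<times> 'a \<Rightarrow> ('m \<times> 'a) set" where
  "ext_class P x = ext_rel P (tgt (base P) (fst x)) `` {x}"

text \<open>Functions on a fibre of the completion are given on representatives; \<^const>\<open>the_elem\<close> picks the
  common value over all representatives (and all pullbacks, in the case of reindexing).\<close>

definition exc :: "('o, 'm, 'a) doctrine \<Rightarrow> ('o, 'm, ('m \<times> 'a) set) doctrine" where
  "exc P =
     \<lparr>base = base P,
      fib = (\<lambda>A.
        \<lparr>carrier = ext_pairs P A // ext_rel P A,
         eq = (=),
         le = (\<lambda>X Y. \<exists>x\<in>X. \<exists>y\<in>Y. ext_le P x y)\<rparr>),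
      reidx = (\<lambda>f X.
        the_elem {ext_class P (p, reidx P q \<beta>) | g \<beta> p q.
                    (g, \<beta>) \<in> X \<and> is_pullback (base P) f g p q})\<rparr>"


section \<open>The 2-monad and its algebras\<close>

text \<open>The action on a 1-cell from \<open>P\<close> to \<open>R\<close>.\<close>

definition exc_cell ::
  "('o, 'm, 'a) doctrine \<Rightarrow> ('p, 'n, 'b) doctrine \<Rightarrow> ('o, 'm, 'a, 'p, 'n, 'b) cell
    \<Rightarrow> ('o, 'm, ('m \<times> 'a) set, 'p, 'n, ('n \<times> 'b) set) cell" where
  "exc_cell P R = (\<lambda>(F, b).
     (F, \<lambda>A\<in>obj (base P). \<lambda>X\<in>carrier (fib (exc P) A).
       the_elem {ext_class R (on_arr F g, b (src (base P) g) \<alpha>) | g \<alpha>. (g, \<alpha>) \<in> X}))"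

definition exc_unit :: "('o, 'm, 'a) doctrine \<Rightarrow> ('o, 'm, 'a, 'o, 'm, ('m \<times> 'a) set) cell" where
  "exc_unit P =
     (id_ftor (base P),
      \<lambda>A\<in>obj (base P). \<lambda>\<alpha>\<in>carrier (fib P A). ext_class P (ident (base P) A, \<alpha>))"

definition zeta :: "('o, 'm, 'a) doctrine \<Rightarrow> 'o \<Rightarrow> ('m \<times> 'a) set \<Rightarrow> 'a" where
  "zeta P = (\<lambda>A\<in>obj (base P). \<lambda>X\<in>carrier (fib (exc P) A).
     the_elem {ex P f \<alpha> | f \<alpha>. (f, \<alpha>) \<in> X})"

definition zeta_cell :: "('o, 'm, 'a) doctrine \<Rightarrow> ('o, 'm, ('m \<times> 'a) set, 'o, 'm, 'a) cell" where
  "zeta_cell P = (id_ftor (base P), zeta P)"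

definition exc_mult ::
  "('o, 'm, 'a) doctrine
    \<Rightarrow> ('o, 'm, ('m \<times> ('m \<times> 'a) set) set, 'o, 'm, ('m \<times> 'a) set) cell" where
  "exc_mult P = zeta_cell (exc P)"

text \<open>The completion changes the type of the fibres, so the monad is a family of polymorphic
  constants, and the definition of an algebra is stated for it directly.\<close>

definition exc_algebra ::
  "('o, 'm, 'a) doctrine \<Rightarrow> ('o, 'm, ('m \<times> 'a) set, 'o, 'm, 'a) cell \<Rightarrow> bool" where
  "exc_algebra P a \<longleftrightarrow>
     pd_cell (exc P) P a \<and>
     comp_cell (exc (exc P)) a (exc_cell (exc P) P a) = comp_cell (exc (exc P)) a (exc_mult P) \<and>
     comp_cell P a (exc_unit P) = id_cell P"

end

theory Submission
  imports Defs
begin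

text \<open>
  In an existential doctrine \<open>P\<close> the formal quantification \<open>(f, \<alpha>)\<close> has an actual value
  \<open>\<exists>\<^bsub>f\<^esub> \<alpha>\<close>, and \<open>\<zeta>\<close> evaluates it. The axioms of an existential doctrine are what make
  evaluation a 1-cell. The adjunctions make it independent of the representative
  (\<open>ex_mono_ext_le\<close>), Beck-Chevalley makes it natural (\<open>zeta_reidx\<close>), and Frobenius together with
  Beck-Chevalley makes it preserve binary meets (\<open>ex_meet_pullback\<close>). It commutes with
  quantification because left adjoints compose, \<open>\<exists>\<^bsub>g \<odot> h\<^esub> = \<exists>\<^bsub>g\<^esub> \<exists>\<^bsub>h\<^esub>\<close> (\<open>zeta_ex\<close>). The two algebra laws
  follow: evaluating \<open>(id, \<alpha>)\<close> returns \<open>\<alpha>\<close>, and for an element \<open>(g, Y)\<close> of the twofold completion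
  the associativity law reads \<open>\<exists>\<^bsub>g\<^esub> (\<zeta> Y) = \<zeta> (\<exists>\<^sup>e\<^bsub>g\<^esub> Y)\<close>, which is \<open>zeta_ex\<close> again.

  Most of the work is to show that the completion is itself an existential doctrine. It rests on
  one relation between representatives, \<open>ext_over P f x y\<close>, which expresses that \<open>x\<close> lies below the
  reindexing of \<open>y\<close> along \<open>f\<close>. By the universal property of pullbacks it characterises reindexing
  (\<open>ext_over_pullback_iff\<close>) and meets (\<open>ext_over_meet_iff\<close>) by their lower elements, which gives
  independence of all choices, functoriality, and preservation of meets at once. Unfolded, the same
  relation says that \<open>(f \<odot> h, \<alpha>)\<close> lies below \<open>y\<close> when \<open>x = (h, \<alpha>)\<close> (\<open>ext_le_after_iff_over\<close>), and this is
  the left adjoint. Beck-Chevalley and Frobenius for the completion then come from pasting pullbacks.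
\<close>

section \<open>Inf-semilattices\<close>

lemma (in partial_order) eq_if_same_lower:
  assumes "x \<in> carrier L" "y \<in> carrier L"
    and "\<And>z. z \<in> carrier L \<Longrightarrow> z \<sqsubseteq> x \<longleftrightarrow> z \<sqsubseteq> y"
  shows "x = y"
  using assms by (meson le_antisym le_refl)

lemma (in partial_order) eq_if_same_upper:
  assumes "x \<in> carrier L" "y \<in> carrier L"
    and "\<And>z. z \<in> carrier L \<Longrightarrow> x \<sqsubseteq> z \<longleftrightarrow> y \<sqsubseteq> z"
  shows "x = y"
  using assms by (meson le_antisym le_refl)

lemma (in lower_semilattice) le_meet_iff:
  assumes "x \<in> carrier L" "y \<in> carrier L" "z \<in> carrier L"
  shows "z \<sqsubseteq> x \<sqinter> y \<longleftrightarrow> z \<sqsubseteq> x \<and> z \<sqsubseteq> y"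
  using assms by (meson le_trans meet_closed meet_le meet_left meet_right)

lemma (in lower_semilattice) meet_eqI:
  assumes "x \<in> carrier L" "y \<in> carrier L" "m \<in> carrier L"
    and "\<And>z. z \<in> carrier L \<Longrightarrow> z \<sqsubseteq> m \<longleftrightarrow> z \<sqsubseteq> x \<and> z \<sqsubseteq> y"
  shows "x \<sqinter> y = m"
  using assms by (intro eq_if_same_lower) (auto simp: le_meet_iff)

lemma (in inf_semilattice) top_eqI:
  assumes "t \<in> carrier L" "\<And>z. z \<in> carrier L \<Longrightarrow> z \<sqsubseteq> t"
  shows "\<top> = t"
  using assms by (intro eq_if_same_lower) auto

lemma inf_semilatticeI:
  fixes L (structure)
  assumes "partial_order L" and "t \<in> carrier L" "\<And>z. z \<in> carrier L \<Longrightarrow> z \<sqsubseteq> t"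
    and "\<And>x y. \<lbrakk>x \<in> carrier L; y \<in> carrier L\<rbrakk>
      \<Longrightarrow> \<exists>m\<in>carrier L. \<forall>z\<in>carrier L. z \<sqsubseteq> m \<longleftrightarrow> z \<sqsubseteq> x \<and> z \<sqsubseteq> y"
  shows "inf_semilattice L"
proof -
  interpret partial_order L by fact
  show ?thesis
  proof
    show "\<exists>s. is_glb L s {x, y}" if xy: "x \<in> carrier L" "y \<in> carrier L" for x y
    proof -
      obtain m where "m \<in> carrier L" "\<And>z. z \<in> carrier L \<Longrightarrow> z \<sqsubseteq> m \<longleftrightarrow> z \<sqsubseteq> x \<and> z \<sqsubseteq> y"
        using assms(4)[OF xy] by blast
      then have "is_glb L m {x, y}"
        using xy by (auto simp: greatest_def Lower_def)
      then show ?thesis ..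
    qed
    show "\<exists>x. greatest L x (carrier L)"
      using assms(2,3) by (auto simp: greatest_def)
  qed
qed

lemma meet_mapI:
  assumes "inf_semilattice L" "inf_semilattice M" and closed: "h \<in> carrier L \<rightarrow> carrier M"
    and top: "\<And>z. z \<in> carrier M \<Longrightarrow> z \<sqsubseteq>\<^bsub>M\<^esub> h \<top>\<^bsub>L\<^esub>"
    and meet: "\<And>x y z. \<lbrakk>x \<in> carrier L; y \<in> carrier L; z \<in> carrier M\<rbrakk>
      \<Longrightarrow> z \<sqsubseteq>\<^bsub>M\<^esub> h (x \<sqinter>\<^bsub>L\<^esub> y) \<longleftrightarrow> z \<sqsubseteq>\<^bsub>M\<^esub> h x \<and> z \<sqsubseteq>\<^bsub>M\<^esub> h y"
  shows "meet_map L M h"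
proof -
  interpret L: inf_semilattice L by fact
  interpret M: inf_semilattice M by fact
  have mem: "h x \<in> carrier M" if "x \<in> carrier L" for x
    using closed that by auto
  show ?thesis
    unfolding meet_map_def
    by (auto intro!: closed M.top_eqI[symmetric] M.meet_eqI[symmetric] mem top simp: meet)
qed

lemma meet_map_mono:
  assumes "inf_semilattice L" "inf_semilattice M" and h: "meet_map L M h"
    and xy: "x \<in> carrier L" "y \<in> carrier L" "x \<sqsubseteq>\<^bsub>L\<^esub> y"
  shows "h x \<sqsubseteq>\<^bsub>M\<^esub> h y"
proof -
  interpret L: inf_semilattice L by fact
  interpret M: inf_semilattice M by fact
  have mem: "h x \<in> carrier M" "h y \<in> carrier M"
    using h xy by (auto simp: meet_map_def)
  have "x \<sqinter>\<^bsub>L\<^esub> y = x"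
    using xy by (intro L.meet_eqI) (auto intro: L.le_trans)
  then have "h x = h x \<sqinter>\<^bsub>M\<^esub> h y"
    using h xy by (metis meet_map_def)
  then show ?thesis
    using mem M.meet_right by metis
qed

section \<open>Projections and pullbacks\<close>

context category
begin

lemma arr_in_Hom: "f \<in> arr C \<Longrightarrow> f \<in> Hom C (src C f) (tgt C f)"
  by (simp add: Hom_def)

lemma ident_simps [simp]:
  assumes "A \<in> obj C"
  shows "ident C A \<in> arr C" "src C (ident C A) = A" "tgt C (ident C A) = A"
  using ident_hom[OF assms] by (auto simp: Hom_def)

lemma cmp_simps [simp]:
  assumes "f \<in> arr C" "g \<in> arr C" "tgt C f = src C g"
  shows "g \<cdot> f \<in> arr C" "src C (g \<cdot> f) = src C f" "tgt C (g \<cdot> f) = tgt C g"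
  using cmp_hom[of f "src C f" "tgt C f" g "tgt C g"] assms by (auto simp: Hom_def)

lemma ident_cmp [simp]: "\<lbrakk>f \<in> arr C; tgt C f = A\<rbrakk> \<Longrightarrow> ident C A \<cdot> f = f"
  using cmp_ident_left by (auto simp: Hom_def)

lemma cmp_ident [simp]: "\<lbrakk>f \<in> arr C; src C f = A\<rbrakk> \<Longrightarrow> f \<cdot> ident C A = f"
  using cmp_ident_right by (auto simp: Hom_def)

lemma assoc:
  assumes "f \<in> arr C" "g \<in> arr C" "h \<in> arr C" "tgt C f = src C g" "tgt C g = src C h"
  shows "(h \<cdot> g) \<cdot> f = h \<cdot> (g \<cdot> f)"
  using cmp_assoc[of f "src C f" "src C g" g "src C h" h "tgt C h"] assms by (simp add: Hom_def)

lemma product_sym: "is_product C p q \<Longrightarrow> is_product C q p"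
  unfolding is_product_def by metis

lemma projection_iff: "projection C f \<longleftrightarrow> (\<exists>q. is_product C f q)"
  unfolding projection_def using product_sym by blast

lemma projection_arr [simp]: "projection C f \<Longrightarrow> f \<in> arr C"
  unfolding projection_iff is_product_def by auto

lemma is_productI:
  assumes "p \<in> arr C" "q \<in> arr C" "src C p = src C q"
    and "\<And>f g. \<lbrakk>f \<in> arr C; g \<in> arr C; src C f = src C g; tgt C f = tgt C p; tgt C g = tgt C q\<rbrakk>
      \<Longrightarrow> \<exists>u\<in>Hom C (src C f) (src C p). p \<cdot> u = f \<and> q \<cdot> u = g"
    and "\<And>u v. \<lbrakk>u \<in> arr C; v \<in> arr C; src C u = src C v; tgt C u = src C p; tgt C v = src C p;
        p \<cdot> u = p \<cdot> v; q \<cdot> u = q \<cdot> v\<rbrakk> \<Longrightarrow> u = v"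
  shows "is_product C p q"
  unfolding is_product_def
proof (intro conjI ballI)
  fix X f g assume "f \<in> Hom C X (tgt C p)" "g \<in> Hom C X (tgt C q)"
  then obtain u where u: "u \<in> Hom C X (src C p)" "p \<cdot> u = f" "q \<cdot> u = g"
    using assms(4)[of f g] by (auto simp: Hom_def)
  show "\<exists>!u. u \<in> Hom C X (src C p) \<and> p \<cdot> u = f \<and> q \<cdot> u = g"
    using u assms(5) by (intro ex1I[of _ u]) (auto simp: Hom_def)
qed (use assms in auto)

lemma product_pair:
  assumes "is_product C p q" "f \<in> arr C" "g \<in> arr C" "src C f = src C g"
    "tgt C f = tgt C p" "tgt C g = tgt C q"
  obtains u where "u \<in> arr C" "src C u = src C f" "tgt C u = src C p" "p \<cdot> u = f" "q \<cdot> u = g"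
proof -
  have "f \<in> Hom C (src C f) (tgt C p)" "g \<in> Hom C (src C f) (tgt C q)" "src C f \<in> obj C"
    using assms src_obj by (auto simp: Hom_def)
  then show thesis
    using assms(1) that unfolding is_product_def Hom_def by blast
qed

lemma product_cancel:
  assumes "is_product C p q" "u \<in> arr C" "v \<in> arr C" "src C u = src C v"
    "tgt C u = src C p" "tgt C v = src C p" "p \<cdot> u = p \<cdot> v" "q \<cdot> u = q \<cdot> v"
  shows "u = v"
proof -
  have pq: "p \<in> arr C" "q \<in> arr C" "src C q = src C p"
    using assms(1) by (auto simp: is_product_def)
  have "p \<cdot> u \<in> Hom C (src C u) (tgt C p)" "q \<cdot> u \<in> Hom C (src C u) (tgt C q)"
    using assms pq by (auto simp: Hom_def)
  then have "\<exists>!w. w \<in> Hom C (src C u) (src C p) \<and> p \<cdot> w = p \<cdot> u \<and> q \<cdot> w = q \<cdot> u"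
    using assms(1,2) src_obj unfolding is_product_def by blast
  moreover have "u \<in> Hom C (src C u) (src C p)" "v \<in> Hom C (src C u) (src C p)"
    using assms by (auto simp: Hom_def)
  ultimately show ?thesis
    using assms(7,8) by metis
qed

lemma is_pullbackI:
  assumes "f \<in> arr C" "g \<in> arr C" "p \<in> arr C" "q \<in> arr C" "src C p = src C q"
    "tgt C p = src C f" "tgt C q = src C g" "tgt C f = tgt C g" "f \<cdot> p = g \<cdot> q"
    and "\<And>h k. \<lbrakk>h \<in> arr C; k \<in> arr C; src C h = src C k; tgt C h = src C f; tgt C k = src C g;
        f \<cdot> h = g \<cdot> k\<rbrakk> \<Longrightarrow> \<exists>u\<in>Hom C (src C h) (src C p). p \<cdot> u = h \<and> q \<cdot> u = k"
    and "\<And>u v. \<lbrakk>u \<in> arr C; v \<in> arr C; src C u = src C v; tgt C u = src C p; tgt C v = src C p;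
        p \<cdot> u = p \<cdot> v; q \<cdot> u = q \<cdot> v\<rbrakk> \<Longrightarrow> u = v"
  shows "is_pullback C f g p q"
  unfolding is_pullback_def
proof (intro conjI ballI impI)
  fix X h k assume "h \<in> Hom C X (src C f)" "k \<in> Hom C X (src C g)" "f \<cdot> h = g \<cdot> k"
  then obtain u where u: "u \<in> Hom C X (src C p)" "p \<cdot> u = h" "q \<cdot> u = k"
    using assms(10)[of h k] by (auto simp: Hom_def)
  show "\<exists>!u. u \<in> Hom C X (src C p) \<and> p \<cdot> u = h \<and> q \<cdot> u = k"
    using u assms(11) by (intro ex1I[of _ u]) (auto simp: Hom_def)
qed (use assms in auto)

lemma pullback_simps:
  assumes "is_pullback C f g p q"
  shows "f \<in> arr C" "g \<in> arr C" "p \<in> arr C" "q \<in> arr C" "src C q = src C p"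
    "tgt C p = src C f" "tgt C q = src C g" "tgt C g = tgt C f" "f \<cdot> p = g \<cdot> q"
  using assms by (auto simp: is_pullback_def)

lemma pullback_pair:
  assumes "is_pullback C f g p q" "h \<in> arr C" "k \<in> arr C" "src C h = src C k"
    "tgt C h = src C f" "tgt C k = src C g" "f \<cdot> h = g \<cdot> k"
  obtains u where "u \<in> arr C" "src C u = src C h" "tgt C u = src C p" "p \<cdot> u = h" "q \<cdot> u = k"
proof -
  have "h \<in> Hom C (src C h) (src C f)" "k \<in> Hom C (src C h) (src C g)" "src C h \<in> obj C"
    using assms src_obj by (auto simp: Hom_def)
  then have "\<exists>u. u \<in> Hom C (src C h) (src C p) \<and> p \<cdot> u = h \<and> q \<cdot> u = k"
    using assms(1,7) unfolding is_pullback_def by metis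
  then show thesis
    using that by (auto simp: Hom_def)
qed

lemma pullback_cancel:
  assumes pb: "is_pullback C f g p q" and uv: "u \<in> arr C" "v \<in> arr C" "src C u = src C v"
    "tgt C u = src C p" "tgt C v = src C p" "p \<cdot> u = p \<cdot> v" "q \<cdot> u = q \<cdot> v"
  shows "u = v"
proof -
  note s = pullback_simps[OF pb]
  have "f \<cdot> (p \<cdot> u) = g \<cdot> (q \<cdot> u)"
    using s uv by (simp flip: assoc)
  moreover have "p \<cdot> u \<in> Hom C (src C u) (src C f)" "q \<cdot> u \<in> Hom C (src C u) (src C g)"
    using uv s by (auto simp: Hom_def)
  ultimately have "\<exists>!w. w \<in> Hom C (src C u) (src C p) \<and> p \<cdot> w = p \<cdot> u \<and> q \<cdot> w = q \<cdot> u"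
    using pb uv(1) src_obj unfolding is_pullback_def by blast
  moreover have "u \<in> Hom C (src C u) (src C p)" "v \<in> Hom C (src C u) (src C p)"
    using uv by (auto simp: Hom_def)
  ultimately show ?thesis
    using uv(6,7) by metis
qed

lemma pullback_sym: "is_pullback C f g p q \<Longrightarrow> is_pullback C g f q p"
  unfolding is_pullback_def by metis

text \<open>A cone \<open>(k, l)\<close> over \<open>f\<close> and \<open>g \<cdot> h\<close> gives the cone \<open>(k, h \<cdot> l)\<close> over \<open>f\<close> and \<open>g\<close>; its
  factorisation \<open>u\<close> gives the cone \<open>(u, l)\<close> over \<open>q\<close> and \<open>h\<close>, which factors through the second square.
  Both the Beck-Chevalley and the Frobenius law of the completion come down to this lemma.\<close>

lemma pullback_paste:
  assumes 1: "is_pullback C f g p q" and 2: "is_pullback C q h r s"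
  shows "is_pullback C f (g \<cdot> h) (p \<cdot> r) s"
proof -
  note s = pullback_simps[OF 1] pullback_simps[OF 2]
  show ?thesis
  proof (rule is_pullbackI)
    have "f \<cdot> (p \<cdot> r) = (g \<cdot> q) \<cdot> r"
      using s by (simp flip: assoc)
    also have "\<dots> = g \<cdot> (h \<cdot> s)"
      using s by (simp add: assoc)
    also have "\<dots> = (g \<cdot> h) \<cdot> s"
      using s by (simp add: assoc)
    finally show "f \<cdot> (p \<cdot> r) = (g \<cdot> h) \<cdot> s" .
  next
    fix k l assume kl: "k \<in> arr C" "l \<in> arr C" "src C k = src C l" "tgt C k = src C f"
      "tgt C l = src C (g \<cdot> h)" "f \<cdot> k = (g \<cdot> h) \<cdot> l"
    have tl: "tgt C l = src C h"
      using kl s by simp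
    have "f \<cdot> k = g \<cdot> (h \<cdot> l)"
      using assoc[of l h g] kl s(2,4,7) s(10-18) tl by simp
    then obtain u where u: "u \<in> arr C" "src C u = src C k" "tgt C u = src C p" "p \<cdot> u = k"
      "q \<cdot> u = h \<cdot> l"
      using pullback_pair[OF 1, of k "h \<cdot> l"] kl(1-4) s tl by auto
    obtain v where v: "v \<in> arr C" "src C v = src C u" "tgt C v = src C r" "r \<cdot> v = u" "s \<cdot> v = l"
      using pullback_pair[OF 2, of u l] kl s tl u by auto
    show "\<exists>u\<in>Hom C (src C k) (src C (p \<cdot> r)). (p \<cdot> r) \<cdot> u = k \<and> s \<cdot> u = l"
      using u v s by (intro bexI[of _ v]) (auto simp: assoc Hom_def)
  next
    fix u v assume uv: "u \<in> arr C" "v \<in> arr C" "src C u = src C v" "tgt C u = src C (p \<cdot> r)"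
      "tgt C v = src C (p \<cdot> r)" "(p \<cdot> r) \<cdot> u = (p \<cdot> r) \<cdot> v" "s \<cdot> u = s \<cdot> v"
    have t: "tgt C u = src C r" "tgt C v = src C r"
      using uv s by auto
    have "q \<cdot> (r \<cdot> u) = h \<cdot> (s \<cdot> u)" "q \<cdot> (r \<cdot> v) = h \<cdot> (s \<cdot> v)"
      using uv(1,2) s t by (simp_all flip: assoc)
    then have "q \<cdot> (r \<cdot> u) = q \<cdot> (r \<cdot> v)"
      using uv(7) by simp
    moreover have "p \<cdot> (r \<cdot> u) = p \<cdot> (r \<cdot> v)"
      using assoc[of u r p] assoc[of v r p] uv(1,2,6) s t by metis
    ultimately have "r \<cdot> u = r \<cdot> v"
      using uv(1-3) s t by - (rule pullback_cancel[OF 1], simp_all)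
    then show "u = v"
      using uv s t by - (rule pullback_cancel[OF 2], auto)
  qed (use s in auto)
qed

text \<open>If \<open>g\<close> is a leg of a product with other leg \<open>g'\<close>, then \<open>p\<close> is a leg of a product with other
  leg \<open>g' \<cdot> q\<close>: a map into the product object over \<open>h\<close> is the same as a map into \<open>src g\<close>
  over \<open>f \<cdot> h\<close>. Since every choice of pullback is covered, reindexing in the completion
  can be computed with any of them.\<close>

lemma pullback_projection:
  assumes pb: "is_pullback C f g p q" and g: "projection C g"
  shows "projection C p"
proof -
  note s = pullback_simps[OF pb]
  obtain g' where g': "is_product C g g'"
    using g projection_iff by blast
  then have s': "g' \<in> arr C" "src C g' = src C g"
    by (auto simp: is_product_def)
  have "is_product C p (g' \<cdot> q)"
  proof (rule is_productI)
    fix h k assume hk: "h \<in> arr C" "k \<in> arr C" "src C h = src C k" "tgt C h = tgt C p"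
      "tgt C k = tgt C (g' \<cdot> q)"
    obtain u where u: "u \<in> arr C" "src C u = src C h" "tgt C u = src C g" "g \<cdot> u = f \<cdot> h" "g' \<cdot> u = k"
      using product_pair[OF g', of "f \<cdot> h" k] hk s s' by auto
    obtain v where v: "v \<in> arr C" "src C v = src C h" "tgt C v = src C p" "p \<cdot> v = h" "q \<cdot> v = u"
      using pullback_pair[OF pb, of h u] hk s s' u by auto
    show "\<exists>u\<in>Hom C (src C h) (src C p). p \<cdot> u = h \<and> (g' \<cdot> q) \<cdot> u = k"
      using u v s s' by (intro bexI[of _ v]) (auto simp: assoc Hom_def)
  next
    fix u v assume uv: "u \<in> arr C" "v \<in> arr C" "src C u = src C v" "tgt C u = src C p"
      "tgt C v = src C p" "p \<cdot> u = p \<cdot> v" "(g' \<cdot> q) \<cdot> u = (g' \<cdot> q) \<cdot> v"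
    have "g \<cdot> (q \<cdot> u) = f \<cdot> (p \<cdot> u)" "g \<cdot> (q \<cdot> v) = f \<cdot> (p \<cdot> v)"
      using uv(1-5) s by (simp_all flip: assoc)
    then have "q \<cdot> u = q \<cdot> v"
      using uv s s' by - (rule product_cancel[OF g'], auto simp: assoc)
    then show "u = v"
      using uv by - (rule pullback_cancel[OF pb], auto)
  qed (use s s' in auto)
  then show ?thesis
    using projection_iff by blast
qed

end

context fp_category
begin

text \<open>The identity is a product projection because the other factor may be terminal.\<close>

lemma projection_ident:
  assumes "A \<in> obj C"
  shows "projection C (ident C A)"
proof -
  obtain t where t: "is_terminal C t"
    using terminal_exists by blast
  then obtain e where e: "e \<in> arr C" "src C e = A" "tgt C e = t"
    using assms unfolding is_terminal_def Hom_def by blast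
  have uniq: "u = v" if "u \<in> arr C" "v \<in> arr C" "src C u = src C v" "tgt C u = t" "tgt C v = t" for u v
  proof -
    have "\<exists>!w. w \<in> Hom C (src C u) t"
      using t that(1) src_obj unfolding is_terminal_def by blast
    moreover have "u \<in> Hom C (src C u) t" "v \<in> Hom C (src C u) t"
      using that by (auto simp: Hom_def)
    ultimately show ?thesis
      by blast
  qed
  have "is_product C (ident C A) e"
  proof (rule is_productI)
    fix f g assume fg: "f \<in> arr C" "g \<in> arr C" "src C f = src C g"
      "tgt C f = tgt C (ident C A)" "tgt C g = tgt C e"
    then have "e \<cdot> f = g"
      using assms e uniq[of "e \<cdot> f" g] by simp
    then show "\<exists>u\<in>Hom C (src C f) (src C (ident C A)). ident C A \<cdot> u = f \<and> e \<cdot> u = g"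
      using assms e fg by (intro bexI[of _ f]) (auto simp: Hom_def)
  qed (use assms e in auto)
  then show ?thesis
    using projection_iff by blast
qed

text \<open>If \<open>A\<close> is a product of \<open>B\<close> and \<open>D\<close>, and \<open>X\<close> a product of \<open>A\<close> and \<open>E\<close>, then \<open>X\<close> is a product of
  \<open>B\<close> and \<open>D \<times> E\<close>; the complementary leg \<open>c\<close> is the pair of the two complementary legs.\<close>

lemma projection_cmp:
  assumes f: "projection C f" and g: "projection C g" and "tgt C g = src C f"
  shows "projection C (f \<cdot> g)"
proof -
  obtain f' where f': "is_product C f f'"
    using f projection_iff by blast
  obtain g' where g': "is_product C g g'"
    using g projection_iff by blast
  have s: "f \<in> arr C" "g \<in> arr C" "f' \<in> arr C" "g' \<in> arr C" "src C f' = src C f" "src C g' = src C g"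
    "tgt C g = src C f"
    using assms f' g' by (auto simp: is_product_def)
  obtain p q where pq: "is_product C p q" "tgt C p = tgt C f'" "tgt C q = tgt C g'"
    using product_exists tgt_obj s by metis
  then have spq: "p \<in> arr C" "q \<in> arr C" "src C q = src C p"
    by (auto simp: is_product_def)
  obtain c where c: "c \<in> arr C" "src C c = src C g" "tgt C c = src C p" "p \<cdot> c = f' \<cdot> g" "q \<cdot> c = g'"
    using product_pair[OF pq(1), of "f' \<cdot> g" g'] s pq by auto
  \<comment> \<open>The components of \<open>c \<cdot> u\<close> are the complementary components of \<open>g \<cdot> u\<close> and of \<open>u\<close>.\<close>
  have pcu: "f' \<cdot> (g \<cdot> u) = p \<cdot> (c \<cdot> u)" "g' \<cdot> u = q \<cdot> (c \<cdot> u)"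
    if "u \<in> arr C" "tgt C u = src C g" for u
    using that s spq c by (metis assoc)+
  have "is_product C (f \<cdot> g) c"
  proof (rule is_productI)
    fix h k assume hk: "h \<in> arr C" "k \<in> arr C" "src C h = src C k" "tgt C h = tgt C (f \<cdot> g)"
      "tgt C k = tgt C c"
    obtain u where u: "u \<in> arr C" "src C u = src C h" "tgt C u = src C f" "f \<cdot> u = h" "f' \<cdot> u = p \<cdot> k"
      using product_pair[OF f', of h "p \<cdot> k"] hk s spq c pq by auto
    obtain v where v: "v \<in> arr C" "src C v = src C h" "tgt C v = src C g" "g \<cdot> v = u" "g' \<cdot> v = q \<cdot> k"
      using product_pair[OF g', of u "q \<cdot> k"] hk s spq c pq u by auto
    have "c \<cdot> v = k"
      using pcu[OF v(1,3)] hk s spq c pq u v by - (rule product_cancel[OF pq(1)], auto)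
    then show "\<exists>u\<in>Hom C (src C h) (src C (f \<cdot> g)). (f \<cdot> g) \<cdot> u = h \<and> c \<cdot> u = k"
      using u v s by (intro bexI[of _ v]) (auto simp: assoc Hom_def)
  next
    fix u v assume uv: "u \<in> arr C" "v \<in> arr C" "src C u = src C v" "tgt C u = src C (f \<cdot> g)"
      "tgt C v = src C (f \<cdot> g)" "(f \<cdot> g) \<cdot> u = (f \<cdot> g) \<cdot> v" "c \<cdot> u = c \<cdot> v"
    have t: "tgt C u = src C g" "tgt C v = src C g"
      using uv s by auto
    have "g \<cdot> u = g \<cdot> v"
      using uv s t pcu[OF uv(1) t(1)] pcu[OF uv(2) t(2)]
      by - (rule product_cancel[OF f'], auto simp: assoc)
    then show "u = v"
      using uv s t pcu[OF uv(1) t(1)] pcu[OF uv(2) t(2)]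
      by - (rule product_cancel[OF g'], auto)
  qed (use s c in auto)
  then show ?thesis
    using projection_iff by blast
qed

text \<open>Arbitrary pullbacks need not exist in the base, but along a projection \<open>B \<times> D \<rightarrow> B\<close>
  the pullback of \<open>f : A \<rightarrow> B\<close> is the product \<open>A \<times> D\<close>.\<close>

lemma pullback_exists:
  assumes g: "projection C g" and f: "f \<in> arr C" "tgt C f = tgt C g"
  obtains p q where "is_pullback C f g p q"
proof -
  obtain g' where g': "is_product C g g'"
    using g projection_iff by blast
  have s: "g \<in> arr C" "g' \<in> arr C" "src C g' = src C g"
    using g' by (auto simp: is_product_def)
  obtain p r where pr: "is_product C p r" "tgt C p = src C f" "tgt C r = tgt C g'"
    using product_exists tgt_obj src_obj s f by metis
  then have spr: "p \<in> arr C" "r \<in> arr C" "src C r = src C p"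
    by (auto simp: is_product_def)
  obtain q where q: "q \<in> arr C" "src C q = src C p" "tgt C q = src C g" "g \<cdot> q = f \<cdot> p" "g' \<cdot> q = r"
    using product_pair[OF g', of "f \<cdot> p" r] s pr spr f by auto
  \<comment> \<open>Composites with \<open>p\<close> and \<open>q\<close> determine those with \<open>p\<close> and \<open>r\<close>, and a map into the product
    \<open>src p\<close> is determined by the latter.\<close>
  have qu: "g \<cdot> (q \<cdot> u) = f \<cdot> (p \<cdot> u)" "g' \<cdot> (q \<cdot> u) = r \<cdot> u"
    if "u \<in> arr C" "tgt C u = src C p" for u
    using that s spr pr q f by (metis assoc)+
  have "is_pullback C f g p q"
  proof (rule is_pullbackI)
    fix h k assume hk: "h \<in> arr C" "k \<in> arr C" "src C h = src C k" "tgt C h = src C f"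
      "tgt C k = src C g" "f \<cdot> h = g \<cdot> k"
    obtain u where u: "u \<in> arr C" "src C u = src C h" "tgt C u = src C p" "p \<cdot> u = h" "r \<cdot> u = g' \<cdot> k"
      using product_pair[OF pr(1), of h "g' \<cdot> k"] hk s pr by auto
    have "q \<cdot> u = k"
      using qu[OF u(1,3)] hk s q u by - (rule product_cancel[OF g'], auto)
    then show "\<exists>u\<in>Hom C (src C h) (src C p). p \<cdot> u = h \<and> q \<cdot> u = k"
      using u by (intro bexI[of _ u]) (auto simp: Hom_def)
  next
    fix u v assume uv: "u \<in> arr C" "v \<in> arr C" "src C u = src C v" "tgt C u = src C p"
      "tgt C v = src C p" "p \<cdot> u = p \<cdot> v" "q \<cdot> u = q \<cdot> v"
    then show "u = v"
      using qu[of u] qu[of v] by - (rule product_cancel[OF pr(1)], auto)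
  qed (use s spr pr q f in auto)
  then show thesis
    using that by blast
qed

end

section \<open>The order of the completion, relative to a map of the base\<close>

text \<open>The order on pairs, displaced along a map \<open>f\<close> of the base: \<open>(h, \<alpha>)\<close> lives over the source of \<open>f\<close>
  and \<open>(g, \<gamma>)\<close> over its target. In terms of the completion this says that \<open>(h, \<alpha>)\<close> lies below the
  reindexing of \<open>(g, \<gamma>)\<close> along \<open>f\<close>, but it is stated on representatives and without a choice of pullback.\<close>

definition ext_over :: "('o, 'm, 'a) doctrine \<Rightarrow> 'm \<Rightarrow> 'm \<times> 'a \<Rightarrow> 'm \<times> 'a \<Rightarrow> bool" where
  "ext_over P f = (\<lambda>(h, \<alpha>) (g, \<gamma>).
     \<exists>w\<in>Hom (base P) (src (base P) h) (src (base P) g).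
       g \<cdot>\<^bsub>base P\<^esub> w = f \<cdot>\<^bsub>base P\<^esub> h \<and> \<alpha> \<sqsubseteq>\<^bsub>fib P (src (base P) h)\<^esub> reidx P w \<gamma>)"

context primary_doctrine
begin

sublocale base: fp_category "base P"
  by (rule base_fp)

abbreviation after (infixr \<open>\<odot>\<close> 75) where "g \<odot> f \<equiv> g \<cdot>\<^bsub>base P\<^esub> f"

lemma reidx_map:
  "f \<in> arr (base P) \<Longrightarrow> meet_map (fib P (tgt (base P) f)) (fib P (src (base P) f)) (reidx P f)"
  using reidx_meet_map base.arr_in_Hom by blast

lemma reidx_closed:
  "\<lbrakk>f \<in> arr (base P); src (base P) f = A; \<alpha> \<in> carrier (fib P (tgt (base P) f))\<rbrakk>
    \<Longrightarrow> reidx P f \<alpha> \<in> carrier (fib P A)"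
  using reidx_map[of f] by (auto simp: meet_map_def)

lemma reidx_mono:
  assumes "f \<in> arr (base P)" "\<alpha> \<in> carrier (fib P (tgt (base P) f))"
    "\<beta> \<in> carrier (fib P (tgt (base P) f))" "\<alpha> \<sqsubseteq>\<^bsub>fib P (tgt (base P) f)\<^esub> \<beta>"
  shows "reidx P f \<alpha> \<sqsubseteq>\<^bsub>fib P (src (base P) f)\<^esub> reidx P f \<beta>"
  using assms by (intro meet_map_mono[OF _ _ reidx_map])
    (auto intro: fib_inf_semilattice base.src_obj base.tgt_obj)

lemma reidx_meet:
  "\<lbrakk>f \<in> arr (base P); \<alpha> \<in> carrier (fib P (tgt (base P) f));
    \<beta> \<in> carrier (fib P (tgt (base P) f))\<rbrakk>
    \<Longrightarrow> reidx P f (\<alpha> \<sqinter>\<^bsub>fib P (tgt (base P) f)\<^esub> \<beta>)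
      = reidx P f \<alpha> \<sqinter>\<^bsub>fib P (src (base P) f)\<^esub> reidx P f \<beta>"
  using reidx_map unfolding meet_map_def by blast

lemma reidx_top:
  "f \<in> arr (base P) \<Longrightarrow> reidx P f \<top>\<^bsub>fib P (tgt (base P) f)\<^esub> = \<top>\<^bsub>fib P (src (base P) f)\<^esub>"
  using reidx_map unfolding meet_map_def by blast

lemma reidx_after:
  "\<lbrakk>f \<in> arr (base P); g \<in> arr (base P); tgt (base P) f = src (base P) g;
    \<alpha> \<in> carrier (fib P (tgt (base P) g))\<rbrakk> \<Longrightarrow> reidx P (g \<odot> f) \<alpha> = reidx P f (reidx P g \<alpha>)"
  using reidx_cmp[of f "src (base P) f" "src (base P) g" g "tgt (base P) g"]
  by (simp add: Hom_def)

lemma ext_overI: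
  assumes "w \<in> arr (base P)" "src (base P) w = src (base P) h" "tgt (base P) w = src (base P) g"
    "g \<odot> w = f \<odot> h" "\<alpha> \<sqsubseteq>\<^bsub>fib P (src (base P) h)\<^esub> reidx P w \<gamma>"
  shows "ext_over P f (h, \<alpha>) (g, \<gamma>)"
  using assms by (auto simp: ext_over_def Hom_def)

lemma ext_overE:
  assumes "ext_over P f (h, \<alpha>) (g, \<gamma>)"
  obtains w where "w \<in> arr (base P)" "src (base P) w = src (base P) h"
    "tgt (base P) w = src (base P) g" "g \<odot> w = f \<odot> h"
    "\<alpha> \<sqsubseteq>\<^bsub>fib P (src (base P) h)\<^esub> reidx P w \<gamma>"
  using assms by (auto simp: ext_over_def Hom_def)

lemma ext_le_iff_over_ident:
  "x \<in> ext_pairs P A \<Longrightarrow> ext_le P x y \<longleftrightarrow> ext_over P (ident (base P) A) x y"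
  by (auto simp: ext_le_def ext_over_def ext_pairs_def)

text \<open>This is the adjunction between \<open>(h, \<alpha>) \<mapsto> (f \<odot> h, \<alpha>)\<close> and reindexing along \<open>f\<close>, at the level of
  representatives.\<close>

lemma ext_le_after_iff_over:
  assumes "f \<in> arr (base P)" "h \<in> arr (base P)" "tgt (base P) h = src (base P) f"
  shows "ext_le P (f \<odot> h, \<alpha>) y \<longleftrightarrow> ext_over P f (h, \<alpha>) y"
  using assms by (auto simp: ext_le_def ext_over_def)

lemma ext_pairs_obj: "x \<in> ext_pairs P A \<Longrightarrow> A \<in> obj (base P)"
  using base.tgt_obj by (auto simp: ext_pairs_def)

text \<open>The composition law of the displaced order; it yields both transitivity of the order and
  compatibility of the displaced order with representatives.\<close>

lemma ext_over_trans:
  assumes "f \<in> arr (base P)" "g \<in> arr (base P)" "tgt (base P) f = src (base P) g"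
    and "x \<in> ext_pairs P (src (base P) f)" "y \<in> ext_pairs P (src (base P) g)"
      "z \<in> ext_pairs P (tgt (base P) g)"
    and "ext_over P f x y" "ext_over P g y z"
  shows "ext_over P (g \<odot> f) x z"
proof -
  obtain h \<alpha> k \<beta> l \<gamma> where xyz: "x = (h, \<alpha>)" "y = (k, \<beta>)" "z = (l, \<gamma>)"
    by (metis surj_pair)
  have h: "h \<in> arr (base P)" "tgt (base P) h = src (base P) f" "\<alpha> \<in> carrier (fib P (src (base P) h))"
    and k: "k \<in> arr (base P)" "tgt (base P) k = src (base P) g" "\<beta> \<in> carrier (fib P (src (base P) k))"
    and l: "l \<in> arr (base P)" "tgt (base P) l = tgt (base P) g" "\<gamma> \<in> carrier (fib P (src (base P) l))"
    using assms(4-6) by (auto simp: xyz ext_pairs_def)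
  obtain v where v: "v \<in> arr (base P)" "src (base P) v = src (base P) h"
    "tgt (base P) v = src (base P) k" "k \<odot> v = f \<odot> h" "\<alpha> \<sqsubseteq>\<^bsub>fib P (src (base P) h)\<^esub> reidx P v \<beta>"
    using assms(7) unfolding xyz by (rule ext_overE)
  obtain w where w: "w \<in> arr (base P)" "src (base P) w = src (base P) k"
    "tgt (base P) w = src (base P) l" "l \<odot> w = g \<odot> k" "\<beta> \<sqsubseteq>\<^bsub>fib P (src (base P) k)\<^esub> reidx P w \<gamma>"
    using assms(8) unfolding xyz by (rule ext_overE)
  interpret H: inf_semilattice "fib P (src (base P) h)"
    using h base.src_obj fib_inf_semilattice by blast
  show ?thesis
    unfolding xyz
  proof (rule ext_overI)
    have "l \<odot> (w \<odot> v) = (g \<odot> k) \<odot> v"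
      using base.assoc[of v w l] v(1-3) w l by simp
    also have "\<dots> = g \<odot> (f \<odot> h)"
      using base.assoc[of v k g] v k assms(2) by simp
    also have "\<dots> = (g \<odot> f) \<odot> h"
      using base.assoc[of h f g] h assms(1-3) by simp
    finally show "l \<odot> (w \<odot> v) = (g \<odot> f) \<odot> h" .
    have "reidx P v \<beta> \<sqsubseteq>\<^bsub>fib P (src (base P) h)\<^esub> reidx P v (reidx P w \<gamma>)"
      using reidx_mono[of v \<beta> "reidx P w \<gamma>"] v w k l by (simp add: reidx_closed)
    then have "\<alpha> \<sqsubseteq>\<^bsub>fib P (src (base P) h)\<^esub> reidx P v (reidx P w \<gamma>)"
      using H.le_trans[OF v(5)] h k l v w by (simp add: reidx_closed)
    then show "\<alpha> \<sqsubseteq>\<^bsub>fib P (src (base P) h)\<^esub> reidx P (w \<odot> v) \<gamma>"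
      using v w l by (simp add: reidx_after)
  qed (use v w in auto)
qed

lemma ext_pairs_pullback:
  assumes pb: "is_pullback (base P) f g p q" and g: "(g, \<beta>) \<in> ext_pairs P (tgt (base P) f)"
  shows "(p, reidx P q \<beta>) \<in> ext_pairs P (src (base P) f)"
  using base.pullback_simps[OF pb] base.pullback_projection[OF pb] g
  by (auto simp: ext_pairs_def intro: reidx_closed)

lemma ext_pairs_meet:
  assumes pb: "is_pullback (base P) g h p q" and g: "(g, \<alpha>) \<in> ext_pairs P A"
    and h: "(h, \<beta>) \<in> ext_pairs P A"
  shows "(g \<odot> p, reidx P p \<alpha> \<sqinter>\<^bsub>fib P (src (base P) p)\<^esub> reidx P q \<beta>) \<in> ext_pairs P A"
proof -
  note s = base.pullback_simps[OF pb]
  interpret S: inf_semilattice "fib P (src (base P) p)"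
    using s base.src_obj fib_inf_semilattice by blast
  have "projection (base P) p"
    using base.pullback_projection[OF pb] h by (simp add: ext_pairs_def)
  then have "projection (base P) (g \<odot> p)"
    using base.projection_cmp[of g p] g s by (simp add: ext_pairs_def)
  moreover have "reidx P p \<alpha> \<sqinter>\<^bsub>fib P (src (base P) p)\<^esub> reidx P q \<beta> \<in> carrier (fib P (src (base P) p))"
    using g h s by (intro S.meet_closed reidx_closed) (auto simp: ext_pairs_def)
  ultimately show ?thesis
    using base.cmp_simps[of p g] g s by (simp add: ext_pairs_def)
qed

lemma ext_pairs_after:
  "\<lbrakk>projection (base P) f; (h, \<alpha>) \<in> ext_pairs P (src (base P) f)\<rbrakk>
    \<Longrightarrow> (f \<odot> h, \<alpha>) \<in> ext_pairs P (tgt (base P) f)"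
  by (auto simp: ext_pairs_def intro!: base.projection_cmp)

lemma ext_pairs_ident:
  "\<lbrakk>A \<in> obj (base P); \<alpha> \<in> carrier (fib P A)\<rbrakk> \<Longrightarrow> (ident (base P) A, \<alpha>) \<in> ext_pairs P A"
  by (auto simp: ext_pairs_def intro: base.projection_ident)

text \<open>The universal property of the pullback: witnesses into \<open>p\<close> over \<open>f\<close> correspond to witnesses into
  \<open>h\<close> over \<open>g \<odot> f\<close>. For \<open>f\<close> an identity it characterises reindexing along \<open>g\<close>, and for general
  \<open>f\<close> it is what makes reindexing functorial.\<close>

lemma ext_over_pullback_iff:
  assumes pb: "is_pullback (base P) g h p q" and f: "f \<in> arr (base P)" "tgt (base P) f = src (base P) g"
    and x: "x \<in> ext_pairs P (src (base P) f)" and h: "(h, \<beta>) \<in> ext_pairs P (tgt (base P) g)"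
  shows "ext_over P f x (p, reidx P q \<beta>) \<longleftrightarrow> ext_over P (g \<odot> f) x (h, \<beta>)"
proof -
  note s = base.pullback_simps[OF pb]
  obtain k \<alpha> where xk: "x = (k, \<alpha>)"
    by (metis surj_pair)
  have k: "k \<in> arr (base P)" "tgt (base P) k = src (base P) f"
    using x by (auto simp: xk ext_pairs_def)
  have \<beta>: "\<beta> \<in> carrier (fib P (src (base P) h))"
    using h by (simp add: ext_pairs_def)
  show ?thesis
    unfolding xk
  proof
    assume "ext_over P f (k, \<alpha>) (p, reidx P q \<beta>)"
    then obtain w where w: "w \<in> arr (base P)" "src (base P) w = src (base P) k"
      "tgt (base P) w = src (base P) p" "p \<odot> w = f \<odot> k"
      "\<alpha> \<sqsubseteq>\<^bsub>fib P (src (base P) k)\<^esub> reidx P w (reidx P q \<beta>)"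
      by (rule ext_overE)
    show "ext_over P (g \<odot> f) (k, \<alpha>) (h, \<beta>)"
    proof (rule ext_overI)
      show "h \<odot> (q \<odot> w) = (g \<odot> f) \<odot> k"
        using w(1-4) s f k base.assoc by metis
      show "\<alpha> \<sqsubseteq>\<^bsub>fib P (src (base P) k)\<^esub> reidx P (q \<odot> w) \<beta>"
        using w s \<beta> by (simp add: reidx_after)
    qed (use w s in auto)
  next
    assume "ext_over P (g \<odot> f) (k, \<alpha>) (h, \<beta>)"
    then obtain v where v: "v \<in> arr (base P)" "src (base P) v = src (base P) k"
      "tgt (base P) v = src (base P) h" "h \<odot> v = (g \<odot> f) \<odot> k"
      "\<alpha> \<sqsubseteq>\<^bsub>fib P (src (base P) k)\<^esub> reidx P v \<beta>"
      by (rule ext_overE)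
    have "g \<odot> (f \<odot> k) = h \<odot> v"
      using v(4) base.assoc[of k f g] f k s by simp
    then obtain w where w: "w \<in> arr (base P)" "src (base P) w = src (base P) k"
      "tgt (base P) w = src (base P) p" "p \<odot> w = f \<odot> k" "q \<odot> w = v"
      using base.pullback_pair[OF pb, of "f \<odot> k" v] v(1-3) f k s by auto
    show "ext_over P f (k, \<alpha>) (p, reidx P q \<beta>)"
    proof (rule ext_overI)
      show "\<alpha> \<sqsubseteq>\<^bsub>fib P (src (base P) k)\<^esub> reidx P w (reidx P q \<beta>)"
        using reidx_after[of w q \<beta>] v(5) w s \<beta> by simp
    qed (use w in auto)
  qed
qed

text \<open>Two witnesses into \<open>g\<close> and \<open>h\<close> form a cone, hence one witness into their pullback. For \<open>f\<close> an identity
  this says that the pair on the left is a meet, and for general \<open>f\<close> that reindexing preserves it.\<close>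

lemma ext_over_meet_iff:
  assumes pb: "is_pullback (base P) g h p q" and f: "f \<in> arr (base P)"
    and x: "x \<in> ext_pairs P (src (base P) f)"
    and g: "(g, \<alpha>) \<in> ext_pairs P (tgt (base P) f)" and h: "(h, \<beta>) \<in> ext_pairs P (tgt (base P) f)"
  shows "ext_over P f x (g \<odot> p, reidx P p \<alpha> \<sqinter>\<^bsub>fib P (src (base P) p)\<^esub> reidx P q \<beta>)
    \<longleftrightarrow> ext_over P f x (g, \<alpha>) \<and> ext_over P f x (h, \<beta>)"
proof -
  note s = base.pullback_simps[OF pb]
  obtain k \<delta> where xk: "x = (k, \<delta>)"
    by (metis surj_pair)
  have k: "k \<in> arr (base P)" "tgt (base P) k = src (base P) f" "\<delta> \<in> carrier (fib P (src (base P) k))"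
    using x by (auto simp: xk ext_pairs_def)
  have car: "\<alpha> \<in> carrier (fib P (src (base P) g))" "\<beta> \<in> carrier (fib P (src (base P) h))"
    and t: "tgt (base P) g = tgt (base P) f" "tgt (base P) h = tgt (base P) f"
    using g h by (auto simp: ext_pairs_def)
  interpret K: inf_semilattice "fib P (src (base P) k)"
    using k base.src_obj fib_inf_semilattice by blast
  have split: "reidx P w (reidx P p \<alpha> \<sqinter>\<^bsub>fib P (src (base P) p)\<^esub> reidx P q \<beta>)
      = reidx P (p \<odot> w) \<alpha> \<sqinter>\<^bsub>fib P (src (base P) w)\<^esub> reidx P (q \<odot> w) \<beta>"
    if "w \<in> arr (base P)" "tgt (base P) w = src (base P) p" for w
    using reidx_meet[of w "reidx P p \<alpha>" "reidx P q \<beta>"] that s car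
    by (simp add: reidx_after reidx_closed)
  show ?thesis
    unfolding xk
  proof
    assume "ext_over P f (k, \<delta>)
      (g \<odot> p, reidx P p \<alpha> \<sqinter>\<^bsub>fib P (src (base P) p)\<^esub> reidx P q \<beta>)"
    then obtain w where "w \<in> arr (base P)" "src (base P) w = src (base P) k"
      "tgt (base P) w = src (base P) (g \<odot> p)" "(g \<odot> p) \<odot> w = f \<odot> k"
      "\<delta> \<sqsubseteq>\<^bsub>fib P (src (base P) k)\<^esub>
        reidx P w (reidx P p \<alpha> \<sqinter>\<^bsub>fib P (src (base P) p)\<^esub> reidx P q \<beta>)"
      by (rule ext_overE)
    then have w: "w \<in> arr (base P)" "src (base P) w = src (base P) k"
      "tgt (base P) w = src (base P) p" "(g \<odot> p) \<odot> w = f \<odot> k"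
      "\<delta> \<sqsubseteq>\<^bsub>fib P (src (base P) k)\<^esub>
        reidx P (p \<odot> w) \<alpha> \<sqinter>\<^bsub>fib P (src (base P) k)\<^esub> reidx P (q \<odot> w) \<beta>"
      using s by (auto simp: split)
    have "reidx P (p \<odot> w) \<alpha> \<in> carrier (fib P (src (base P) k))"
      "reidx P (q \<odot> w) \<beta> \<in> carrier (fib P (src (base P) k))"
      using w s car by (auto intro!: reidx_closed)
    then have le: "\<delta> \<sqsubseteq>\<^bsub>fib P (src (base P) k)\<^esub> reidx P (p \<odot> w) \<alpha>"
      "\<delta> \<sqsubseteq>\<^bsub>fib P (src (base P) k)\<^esub> reidx P (q \<odot> w) \<beta>"
      using w(5) K.le_meet_iff k by blast+
    have eq: "g \<odot> (p \<odot> w) = f \<odot> k" "h \<odot> (q \<odot> w) = f \<odot> k"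
      using w(1-4) s base.assoc by metis+
    show "ext_over P f (k, \<delta>) (g, \<alpha>) \<and> ext_over P f (k, \<delta>) (h, \<beta>)"
      using ext_overI[of "p \<odot> w" k g f \<delta> \<alpha>] ext_overI[of "q \<odot> w" k h f \<delta> \<beta>] eq le w s by simp
  next
    assume "ext_over P f (k, \<delta>) (g, \<alpha>) \<and> ext_over P f (k, \<delta>) (h, \<beta>)"
    then have gh: "ext_over P f (k, \<delta>) (g, \<alpha>)" "ext_over P f (k, \<delta>) (h, \<beta>)"
      by auto
    obtain u where u: "u \<in> arr (base P)" "src (base P) u = src (base P) k"
      "tgt (base P) u = src (base P) g" "g \<odot> u = f \<odot> k"
      "\<delta> \<sqsubseteq>\<^bsub>fib P (src (base P) k)\<^esub> reidx P u \<alpha>"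
      using gh(1) by (rule ext_overE)
    obtain v where v: "v \<in> arr (base P)" "src (base P) v = src (base P) k"
      "tgt (base P) v = src (base P) h" "h \<odot> v = f \<odot> k"
      "\<delta> \<sqsubseteq>\<^bsub>fib P (src (base P) k)\<^esub> reidx P v \<beta>"
      using gh(2) by (rule ext_overE)
    obtain w where w: "w \<in> arr (base P)" "src (base P) w = src (base P) k"
      "tgt (base P) w = src (base P) p" "p \<odot> w = u" "q \<odot> w = v"
      using base.pullback_pair[OF pb, of u v] u(1-4) v(1-4) by auto
    show "ext_over P f (k, \<delta>)
      (g \<odot> p, reidx P p \<alpha> \<sqinter>\<^bsub>fib P (src (base P) p)\<^esub> reidx P q \<beta>)"
    proof (rule ext_overI)
      show "(g \<odot> p) \<odot> w = f \<odot> k"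
        using base.assoc[of w p g] w s u by simp
      show "\<delta> \<sqsubseteq>\<^bsub>fib P (src (base P) k)\<^esub>
          reidx P w (reidx P p \<alpha> \<sqinter>\<^bsub>fib P (src (base P) p)\<^esub> reidx P q \<beta>)"
        using w u v k car by (simp add: split K.le_meet_iff reidx_closed)
    qed (use w s in auto)
  qed
qed

lemma ext_le_refl:
  assumes "x \<in> ext_pairs P A"
  shows "ext_le P x x"
proof -
  obtain h \<alpha> where x: "x = (h, \<alpha>)"
    by (metis surj_pair)
  have h: "h \<in> arr (base P)" "\<alpha> \<in> carrier (fib P (src (base P) h))" "src (base P) h \<in> obj (base P)"
    using assms base.src_obj by (auto simp: x ext_pairs_def)
  interpret H: inf_semilattice "fib P (src (base P) h)"
    using h fib_inf_semilattice by blast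
  show ?thesis
    using h base.ident_hom
    by (auto simp: x ext_le_def reidx_ident intro!: bexI[of _ "ident (base P) (src (base P) h)"])
qed

lemma ext_le_trans:
  assumes "x \<in> ext_pairs P A" "y \<in> ext_pairs P A" "z \<in> ext_pairs P A" "ext_le P x y" "ext_le P y z"
  shows "ext_le P x z"
proof -
  have A: "A \<in> obj (base P)"
    using assms(1) by (rule ext_pairs_obj)
  then show ?thesis
    using ext_over_trans[of "ident (base P) A" "ident (base P) A" x y z] assms
    by (simp add: ext_le_iff_over_ident)
qed

lemma ext_over_mono:
  assumes "f \<in> arr (base P)" "x \<in> ext_pairs P (src (base P) f)" "y \<in> ext_pairs P (tgt (base P) f)"
    "z \<in> ext_pairs P (tgt (base P) f)" "ext_over P f x y" "ext_le P y z"
  shows "ext_over P f x z"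
  using ext_over_trans[of f "ident (base P) (tgt (base P) f)" x y z] assms base.tgt_obj
  by (simp add: ext_le_iff_over_ident)

section \<open>The completion is a primary doctrine\<close>

lemma exc_base [simp]: "base (exc P) = base P"
  by (simp add: exc_def)

lemma exc_carrier: "carrier (fib (exc P) A) = ext_pairs P A // ext_rel P A"
  by (simp add: exc_def)

lemma ext_class_eq: "x \<in> ext_pairs P A \<Longrightarrow> ext_class P x = ext_rel P A `` {x}"
  by (auto simp: ext_class_def ext_pairs_def)

lemma equiv_ext_rel: "equiv (ext_pairs P A) (ext_rel P A)"
proof (rule equivI)
  show "ext_rel P A \<subseteq> ext_pairs P A \<times> ext_pairs P A"
    by (auto simp: ext_rel_def)
  show "refl_on (ext_pairs P A) (ext_rel P A)"
    by (rule refl_onI) (auto simp: ext_rel_def ext_le_refl)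
  show "sym (ext_rel P A)"
    by (rule symI) (auto simp: ext_rel_def)
  show "trans (ext_rel P A)"
    by (rule transI) (auto simp: ext_rel_def intro: ext_le_trans)
qed

lemma ext_class_closed: "x \<in> ext_pairs P A \<Longrightarrow> ext_class P x \<in> carrier (fib (exc P) A)"
  by (simp add: exc_carrier ext_class_eq quotientI)

lemma exc_carrierE:
  assumes "X \<in> carrier (fib (exc P) A)"
  obtains x where "x \<in> ext_pairs P A" "X = ext_class P x"
  using assms unfolding exc_carrier by (elim quotientE) (auto simp: ext_class_eq)

lemma ext_class_self: "x \<in> ext_pairs P A \<Longrightarrow> x \<in> ext_class P x"
  using equiv_class_self[OF equiv_ext_rel] by (simp add: ext_class_eq)

lemma ext_class_memD:
  assumes "y \<in> ext_class P x" "x \<in> ext_pairs P A"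
  shows "y \<in> ext_pairs P A" "ext_le P x y" "ext_le P y x"
  using assms by (auto simp: ext_class_eq ext_rel_def)

lemma ext_class_eq_iff:
  "\<lbrakk>x \<in> ext_pairs P A; y \<in> ext_pairs P A\<rbrakk>
    \<Longrightarrow> ext_class P x = ext_class P y \<longleftrightarrow> ext_le P x y \<and> ext_le P y x"
  using eq_equiv_class_iff[OF equiv_ext_rel] by (auto simp: ext_class_eq ext_rel_def)

lemma ext_class_le_iff:
  assumes "x \<in> ext_pairs P A" "y \<in> ext_pairs P A"
  shows "ext_class P x \<sqsubseteq>\<^bsub>fib (exc P) A\<^esub> ext_class P y \<longleftrightarrow> ext_le P x y"
proof
  assume "ext_class P x \<sqsubseteq>\<^bsub>fib (exc P) A\<^esub> ext_class P y"
  then obtain x' y' where xy: "x' \<in> ext_class P x" "y' \<in> ext_class P y" "ext_le P x' y'"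
    by (auto simp: exc_def)
  show "ext_le P x y"
    using ext_class_memD[OF xy(1) assms(1)] ext_class_memD[OF xy(2) assms(2)] xy(3) assms
      ext_le_trans by meson
next
  assume "ext_le P x y"
  then show "ext_class P x \<sqsubseteq>\<^bsub>fib (exc P) A\<^esub> ext_class P y"
    using assms[THEN ext_class_self] by (auto simp: exc_def)
qed

lemma exc_partial_order: "partial_order (fib (exc P) A)"
proof
  show "(.=\<^bsub>fib (exc P) A\<^esub>) = (=)"
    by (simp add: exc_def)
  fix X Y Z
  assume X: "X \<in> carrier (fib (exc P) A)"
  then obtain x where x: "x \<in> ext_pairs P A" "X = ext_class P x"
    by (rule exc_carrierE)
  then show "X \<sqsubseteq>\<^bsub>fib (exc P) A\<^esub> X"
    by (simp add: ext_class_le_iff ext_le_refl)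
  assume "Y \<in> carrier (fib (exc P) A)"
  then obtain y where y: "y \<in> ext_pairs P A" "Y = ext_class P y"
    by (rule exc_carrierE)
  show "X .=\<^bsub>fib (exc P) A\<^esub> Y" if "X \<sqsubseteq>\<^bsub>fib (exc P) A\<^esub> Y" "Y \<sqsubseteq>\<^bsub>fib (exc P) A\<^esub> X"
    using that x y by (simp add: ext_class_le_iff ext_class_eq_iff \<open>(.=\<^bsub>fib (exc P) A\<^esub>) = (=)\<close>)
  assume "Z \<in> carrier (fib (exc P) A)"
  then obtain z where z: "z \<in> ext_pairs P A" "Z = ext_class P z"
    by (rule exc_carrierE)
  show "X \<sqsubseteq>\<^bsub>fib (exc P) A\<^esub> Z" if "X \<sqsubseteq>\<^bsub>fib (exc P) A\<^esub> Y" "Y \<sqsubseteq>\<^bsub>fib (exc P) A\<^esub> Z"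
    using that x y z by (auto simp: ext_class_le_iff intro: ext_le_trans)
qed (auto simp: exc_def)

lemma ext_le_ident_top:
  assumes "(k, \<delta>) \<in> ext_pairs P A"
  shows "ext_le P (k, \<delta>) (ident (base P) A, \<top>\<^bsub>fib P A\<^esub>)"
proof -
  have k: "k \<in> arr (base P)" "tgt (base P) k = A" "\<delta> \<in> carrier (fib P (src (base P) k))"
    "A \<in> obj (base P)" "src (base P) k \<in> obj (base P)"
    using assms ext_pairs_obj base.src_obj by (auto simp: ext_pairs_def)
  interpret K: inf_semilattice "fib P (src (base P) k)"
    using k fib_inf_semilattice by blast
  have "reidx P k \<top>\<^bsub>fib P A\<^esub> = \<top>\<^bsub>fib P (src (base P) k)\<^esub>"
    using k reidx_top by blast
  then show ?thesis
    using k by (auto simp: ext_le_def Hom_def intro!: bexI[of _ k])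
qed

lemma exc_inf_semilattice:
  assumes A: "A \<in> obj (base P)"
  shows "inf_semilattice (fib (exc P) A)"
proof (rule inf_semilatticeI)
  interpret A: inf_semilattice "fib P A"
    using A by (rule fib_inf_semilattice)
  have t: "(ident (base P) A, \<top>\<^bsub>fib P A\<^esub>) \<in> ext_pairs P A"
    using A by (intro ext_pairs_ident) auto
  show "ext_class P (ident (base P) A, \<top>\<^bsub>fib P A\<^esub>) \<in> carrier (fib (exc P) A)"
    using t by (rule ext_class_closed)
  show "Z \<sqsubseteq>\<^bsub>fib (exc P) A\<^esub> ext_class P (ident (base P) A, \<top>\<^bsub>fib P A\<^esub>)"
    if "Z \<in> carrier (fib (exc P) A)" for Z
    using that t by (auto elim!: exc_carrierE simp: ext_class_le_iff ext_le_ident_top)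
  fix X Y assume "X \<in> carrier (fib (exc P) A)" "Y \<in> carrier (fib (exc P) A)"
  then obtain g \<alpha> h \<beta> where g: "(g, \<alpha>) \<in> ext_pairs P A" "X = ext_class P (g, \<alpha>)"
    and h: "(h, \<beta>) \<in> ext_pairs P A" "Y = ext_class P (h, \<beta>)"
    by (metis exc_carrierE surj_pair)
  obtain p q where pb: "is_pullback (base P) g h p q"
    using base.pullback_exists[of h g] g h by (auto simp: ext_pairs_def)
  let ?m = "(g \<odot> p, reidx P p \<alpha> \<sqinter>\<^bsub>fib P (src (base P) p)\<^esub> reidx P q \<beta>)"
  have m: "?m \<in> ext_pairs P A"
    using pb g(1) h(1) by (rule ext_pairs_meet)
  have "Z \<sqsubseteq>\<^bsub>fib (exc P) A\<^esub> ext_class P ?m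
      \<longleftrightarrow> Z \<sqsubseteq>\<^bsub>fib (exc P) A\<^esub> X \<and> Z \<sqsubseteq>\<^bsub>fib (exc P) A\<^esub> Y"
    if Z: "Z \<in> carrier (fib (exc P) A)" for Z
  proof -
    obtain z where z: "z \<in> ext_pairs P A" "Z = ext_class P z"
      using Z by (rule exc_carrierE)
    show ?thesis
      using ext_over_meet_iff[OF pb, of "ident (base P) A" z \<alpha> \<beta>] z g h m A
      by (simp add: ext_class_le_iff ext_le_iff_over_ident)
  qed
  then show "\<exists>m\<in>carrier (fib (exc P) A). \<forall>Z\<in>carrier (fib (exc P) A).
      Z \<sqsubseteq>\<^bsub>fib (exc P) A\<^esub> m
      \<longleftrightarrow> Z \<sqsubseteq>\<^bsub>fib (exc P) A\<^esub> X \<and> Z \<sqsubseteq>\<^bsub>fib (exc P) A\<^esub> Y"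
    using ext_class_closed[OF m] by blast
qed (rule exc_partial_order)

lemma exc_top:
  assumes "A \<in> obj (base P)"
  shows "\<top>\<^bsub>fib (exc P) A\<^esub> = ext_class P (ident (base P) A, \<top>\<^bsub>fib P A\<^esub>)"
proof -
  interpret A: inf_semilattice "fib P A"
    using assms by (rule fib_inf_semilattice)
  interpret E: inf_semilattice "fib (exc P) A"
    using assms by (rule exc_inf_semilattice)
  have t: "(ident (base P) A, \<top>\<^bsub>fib P A\<^esub>) \<in> ext_pairs P A"
    using assms by (intro ext_pairs_ident) auto
  then show ?thesis
    by (intro E.top_eqI) (auto intro: ext_class_closed elim!: exc_carrierE
        simp: ext_class_le_iff ext_le_ident_top)
qed

lemma exc_meet:
  assumes pb: "is_pullback (base P) g h p q"
    and g: "(g, \<alpha>) \<in> ext_pairs P A" and h: "(h, \<beta>) \<in> ext_pairs P A"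
  shows "ext_class P (g, \<alpha>) \<sqinter>\<^bsub>fib (exc P) A\<^esub> ext_class P (h, \<beta>)
    = ext_class P (g \<odot> p, reidx P p \<alpha> \<sqinter>\<^bsub>fib P (src (base P) p)\<^esub> reidx P q \<beta>)"
proof -
  have A: "A \<in> obj (base P)"
    using g by (rule ext_pairs_obj)
  interpret E: inf_semilattice "fib (exc P) A"
    using A by (rule exc_inf_semilattice)
  let ?m = "(g \<odot> p, reidx P p \<alpha> \<sqinter>\<^bsub>fib P (src (base P) p)\<^esub> reidx P q \<beta>)"
  have m: "?m \<in> ext_pairs P A"
    using pb g(1) h(1) by (rule ext_pairs_meet)
  show ?thesis
  proof (rule E.meet_eqI)
    fix Z assume "Z \<in> carrier (fib (exc P) A)"
    then obtain z where z: "z \<in> ext_pairs P A" "Z = ext_class P z"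
      by (rule exc_carrierE)
    show "Z \<sqsubseteq>\<^bsub>fib (exc P) A\<^esub> ext_class P ?m
      \<longleftrightarrow> Z \<sqsubseteq>\<^bsub>fib (exc P) A\<^esub> ext_class P (g, \<alpha>)
        \<and> Z \<sqsubseteq>\<^bsub>fib (exc P) A\<^esub> ext_class P (h, \<beta>)"
      using ext_over_meet_iff[OF pb, of "ident (base P) A" z \<alpha> \<beta>] z g h m A
      by (simp add: ext_class_le_iff ext_le_iff_over_ident)
  qed (use g h m in \<open>auto intro: ext_class_closed\<close>)
qed

text \<open>Elements that have the same lower elements are equal, and by \<open>ext_over_pullback_iff\<close> the lower
  elements of \<open>(p', P\<^bsub>q'\<^esub> \<beta>')\<close> are the pairs related to \<open>(g', \<beta>')\<close> by \<open>ext_over P f\<close>,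
  a condition that is invariant under equivalence of \<open>(g', \<beta>')\<close>. So the set in the definition of
  reindexing is a singleton.\<close>

lemma exc_reidx:
  assumes pb: "is_pullback (base P) f g p q" and g: "(g, \<beta>) \<in> ext_pairs P (tgt (base P) f)"
  shows "reidx (exc P) f (ext_class P (g, \<beta>)) = ext_class P (p, reidx P q \<beta>)"
proof -
  have f: "f \<in> arr (base P)" "src (base P) f \<in> obj (base P)"
    using base.pullback_simps[OF pb] base.src_obj by auto
  have le: "ext_le P x (p', reidx P q' \<beta>') \<longleftrightarrow> ext_over P f x (g', \<beta>')"
    if "is_pullback (base P) f g' p' q'" "(g', \<beta>') \<in> ext_pairs P (tgt (base P) f)"
      "x \<in> ext_pairs P (src (base P) f)" for x g' \<beta>' p' q'
    using ext_over_pullback_iff[OF that(1), of "ident (base P) (src (base P) f)" x] that f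
    by (simp add: ext_le_iff_over_ident)
  have "ext_class P (p', reidx P q' \<beta>') = ext_class P (p, reidx P q \<beta>)"
    if g': "(g', \<beta>') \<in> ext_class P (g, \<beta>)" and pb': "is_pullback (base P) f g' p' q'" for g' \<beta>' p' q'
  proof -
    note mem = ext_class_memD[OF g' g]
    have iff: "ext_over P f x (g', \<beta>') \<longleftrightarrow> ext_over P f x (g, \<beta>)"
      if "x \<in> ext_pairs P (src (base P) f)" for x
      using ext_over_mono f that mem g by blast
    have p: "(p, reidx P q \<beta>) \<in> ext_pairs P (src (base P) f)"
      "(p', reidx P q' \<beta>') \<in> ext_pairs P (src (base P) f)"
      using ext_pairs_pullback[OF pb g] ext_pairs_pullback[OF pb' mem(1)] by auto
    have "ext_le P (p', reidx P q' \<beta>') (p, reidx P q \<beta>)"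
      using le[OF pb' mem(1) p(2)] le[OF pb g p(2)] iff[OF p(2)] ext_le_refl[OF p(2)] by simp
    moreover have "ext_le P (p, reidx P q \<beta>) (p', reidx P q' \<beta>')"
      using le[OF pb' mem(1) p(1)] le[OF pb g p(1)] iff[OF p(1)] ext_le_refl[OF p(1)] by simp
    ultimately show ?thesis
      using p ext_class_eq_iff by blast
  qed
  then have "{ext_class P (p', reidx P q' \<beta>') | g' \<beta>' p' q'.
      (g', \<beta>') \<in> ext_class P (g, \<beta>) \<and> is_pullback (base P) f g' p' q'}
    \<subseteq> {ext_class P (p, reidx P q \<beta>)}" (is "?S \<subseteq> _")
    by clarsimp
  moreover have "ext_class P (p, reidx P q \<beta>) \<in> ?S"
    using pb ext_class_self[OF g] by blast
  ultimately have "?S = {ext_class P (p, reidx P q \<beta>)}"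
    by blast
  then show ?thesis
    by (simp add: exc_def)
qed

lemma exc_reidxE:
  assumes f: "f \<in> arr (base P)" and y: "(g, \<beta>) \<in> ext_pairs P (tgt (base P) f)"
  obtains p q where "is_pullback (base P) f g p q"
    "(p, reidx P q \<beta>) \<in> ext_pairs P (src (base P) f)"
    "reidx (exc P) f (ext_class P (g, \<beta>)) = ext_class P (p, reidx P q \<beta>)"
proof -
  obtain p q where "is_pullback (base P) f g p q"
    using base.pullback_exists[of g f] f y by (auto simp: ext_pairs_def)
  then show thesis
    using that exc_reidx ext_pairs_pullback y by blast
qed

lemma exc_reidx_closed:
  assumes f: "f \<in> arr (base P)" and Y: "Y \<in> carrier (fib (exc P) (tgt (base P) f))"
  shows "reidx (exc P) f Y \<in> carrier (fib (exc P) (src (base P) f))"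
proof -
  obtain g \<beta> where g: "(g, \<beta>) \<in> ext_pairs P (tgt (base P) f)" "Y = ext_class P (g, \<beta>)"
    using Y by (metis exc_carrierE surj_pair)
  show ?thesis
    using f g(1) by (rule exc_reidxE) (simp add: g(2) ext_class_closed)
qed

text \<open>This describes the reindexing along \<open>f\<close> by its lower elements, so that identities between
  reindexed elements reduce to statements about the displaced order.\<close>

lemma exc_le_reidx_iff:
  assumes f: "f \<in> arr (base P)" and x: "x \<in> ext_pairs P (src (base P) f)"
    and y: "y \<in> ext_pairs P (tgt (base P) f)"
  shows "ext_class P x \<sqsubseteq>\<^bsub>fib (exc P) (src (base P) f)\<^esub> reidx (exc P) f (ext_class P y)
    \<longleftrightarrow> ext_over P f x y"
proof -
  obtain g \<beta> where y': "y = (g, \<beta>)"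
    by (metis surj_pair)
  obtain p q where p: "is_pullback (base P) f g p q"
    "(p, reidx P q \<beta>) \<in> ext_pairs P (src (base P) f)"
    "reidx (exc P) f (ext_class P (g, \<beta>)) = ext_class P (p, reidx P q \<beta>)"
    using exc_reidxE[OF f] y unfolding y' by blast
  then show ?thesis
    using ext_over_pullback_iff[OF p(1), of "ident (base P) (src (base P) f)" x] x y f base.src_obj
    by (simp add: y' ext_class_le_iff ext_le_iff_over_ident)
qed

lemma exc_reidx_ident:
  assumes A: "A \<in> obj (base P)" and X: "X \<in> carrier (fib (exc P) A)"
  shows "reidx (exc P) (ident (base P) A) X = X"
proof -
  interpret E: partial_order "fib (exc P) A"
    by (rule exc_partial_order)
  obtain x where x: "x \<in> ext_pairs P A" "X = ext_class P x"
    using X by (rule exc_carrierE)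
  show ?thesis
  proof (rule E.eq_if_same_lower)
    fix Z assume "Z \<in> carrier (fib (exc P) A)"
    then obtain z where z: "z \<in> ext_pairs P A" "Z = ext_class P z"
      by (rule exc_carrierE)
    show "Z \<sqsubseteq>\<^bsub>fib (exc P) A\<^esub> reidx (exc P) (ident (base P) A) X
      \<longleftrightarrow> Z \<sqsubseteq>\<^bsub>fib (exc P) A\<^esub> X"
      using exc_le_reidx_iff[of "ident (base P) A" z x] A x z
      by (simp add: ext_class_le_iff ext_le_iff_over_ident)
  qed (use A X exc_reidx_closed[of "ident (base P) A" X] in auto)
qed

lemma exc_reidx_after:
  assumes fg: "f \<in> arr (base P)" "g \<in> arr (base P)" "tgt (base P) f = src (base P) g"
    and X: "X \<in> carrier (fib (exc P) (tgt (base P) g))"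
  shows "reidx (exc P) (g \<odot> f) X = reidx (exc P) f (reidx (exc P) g X)"
proof -
  interpret E: partial_order "fib (exc P) (src (base P) f)"
    by (rule exc_partial_order)
  obtain h \<beta> where h: "(h, \<beta>) \<in> ext_pairs P (tgt (base P) g)" "X = ext_class P (h, \<beta>)"
    using X by (metis exc_carrierE surj_pair)
  obtain p q where p: "is_pullback (base P) g h p q"
    "(p, reidx P q \<beta>) \<in> ext_pairs P (src (base P) g)"
    "reidx (exc P) g X = ext_class P (p, reidx P q \<beta>)"
    using exc_reidxE[OF fg(2) h(1)] unfolding h(2) by blast
  show ?thesis
  proof (rule E.eq_if_same_lower)
    fix Z assume "Z \<in> carrier (fib (exc P) (src (base P) f))"
    then obtain z where z: "z \<in> ext_pairs P (src (base P) f)" "Z = ext_class P z"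
      by (rule exc_carrierE)
    have "Z \<sqsubseteq>\<^bsub>fib (exc P) (src (base P) f)\<^esub> reidx (exc P) (g \<odot> f) X
        \<longleftrightarrow> ext_over P (g \<odot> f) z (h, \<beta>)"
      using exc_le_reidx_iff[of "g \<odot> f" z "(h, \<beta>)"] fg h z by simp
    also have "\<dots> \<longleftrightarrow> ext_over P f z (p, reidx P q \<beta>)"
      using ext_over_pullback_iff[OF p(1) fg(1,3) z(1) h(1)] by simp
    also have "\<dots> \<longleftrightarrow> Z \<sqsubseteq>\<^bsub>fib (exc P) (src (base P) f)\<^esub> reidx (exc P) f (reidx (exc P) g X)"
      using exc_le_reidx_iff[of f z "(p, reidx P q \<beta>)"] fg p z by simp
    finally show "Z \<sqsubseteq>\<^bsub>fib (exc P) (src (base P) f)\<^esub> reidx (exc P) (g \<odot> f) X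
      \<longleftrightarrow> Z \<sqsubseteq>\<^bsub>fib (exc P) (src (base P) f)\<^esub> reidx (exc P) f (reidx (exc P) g X)" .
  qed (use fg X exc_reidx_closed[of "g \<odot> f" X] exc_reidx_closed[of g X]
      exc_reidx_closed[of f "reidx (exc P) g X"] in auto)
qed

lemma exc_reidx_map:
  assumes f: "f \<in> arr (base P)"
  shows "meet_map (fib (exc P) (tgt (base P) f)) (fib (exc P) (src (base P) f)) (reidx (exc P) f)"
proof (rule meet_mapI)
  have obj: "src (base P) f \<in> obj (base P)" "tgt (base P) f \<in> obj (base P)"
    using f base.src_obj base.tgt_obj by auto
  interpret T: inf_semilattice "fib P (tgt (base P) f)"
    using obj fib_inf_semilattice by blast
  show "inf_semilattice (fib (exc P) (tgt (base P) f))" "inf_semilattice (fib (exc P) (src (base P) f))"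
    using obj exc_inf_semilattice by auto
  show "reidx (exc P) f \<in> carrier (fib (exc P) (tgt (base P) f)) \<rightarrow> carrier (fib (exc P) (src (base P) f))"
    using f exc_reidx_closed by blast
  fix Z assume "Z \<in> carrier (fib (exc P) (src (base P) f))"
  then obtain k \<delta> where z: "(k, \<delta>) \<in> ext_pairs P (src (base P) f)" "Z = ext_class P (k, \<delta>)"
    by (metis exc_carrierE surj_pair)
  let ?t = "(ident (base P) (tgt (base P) f), \<top>\<^bsub>fib P (tgt (base P) f)\<^esub>)"
  have t: "?t \<in> ext_pairs P (tgt (base P) f)"
    using obj by (intro ext_pairs_ident) auto
  have k: "k \<in> arr (base P)" "tgt (base P) k = src (base P) f" "\<delta> \<in> carrier (fib P (src (base P) k))"
    using z by (auto simp: ext_pairs_def)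
  interpret K: inf_semilattice "fib P (src (base P) k)"
    using k base.src_obj fib_inf_semilattice by blast
  have "ext_over P f (k, \<delta>) ?t"
    using f k reidx_top[of "f \<odot> k"] obj by (intro ext_overI[of "f \<odot> k"]) auto
  then show "Z \<sqsubseteq>\<^bsub>fib (exc P) (src (base P) f)\<^esub> reidx (exc P) f \<top>\<^bsub>fib (exc P) (tgt (base P) f)\<^esub>"
    using exc_le_reidx_iff[OF f z(1) t] obj by (simp add: z(2) exc_top)
  fix X Y assume "X \<in> carrier (fib (exc P) (tgt (base P) f))" "Y \<in> carrier (fib (exc P) (tgt (base P) f))"
  then obtain g \<alpha> h \<beta> where g: "(g, \<alpha>) \<in> ext_pairs P (tgt (base P) f)" "X = ext_class P (g, \<alpha>)"
    and h: "(h, \<beta>) \<in> ext_pairs P (tgt (base P) f)" "Y = ext_class P (h, \<beta>)"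
    by (metis exc_carrierE surj_pair)
  obtain p q where pb: "is_pullback (base P) g h p q"
    using base.pullback_exists[of h g] g h by (auto simp: ext_pairs_def)
  show "Z \<sqsubseteq>\<^bsub>fib (exc P) (src (base P) f)\<^esub> reidx (exc P) f (X \<sqinter>\<^bsub>fib (exc P) (tgt (base P) f)\<^esub> Y)
    \<longleftrightarrow> Z \<sqsubseteq>\<^bsub>fib (exc P) (src (base P) f)\<^esub> reidx (exc P) f X
      \<and> Z \<sqsubseteq>\<^bsub>fib (exc P) (src (base P) f)\<^esub> reidx (exc P) f Y"
    using ext_over_meet_iff[OF pb f z(1) g(1) h(1)] exc_meet[OF pb g(1) h(1)]
      exc_le_reidx_iff[OF f z(1) g(1)] exc_le_reidx_iff[OF f z(1) h(1)]
      exc_le_reidx_iff[OF f z(1) ext_pairs_meet[OF pb g(1) h(1)]]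
    by (simp add: g(2) h(2) z(2))
qed

lemma exc_primary: "primary_doctrine (exc P)"
proof (rule primary_doctrine.intro)
  show "fp_category (base (exc P))"
    using base_fp by simp
qed (auto simp: Hom_def exc_inf_semilattice exc_reidx_map exc_reidx_ident exc_reidx_after)

end

section \<open>The completion is an existential doctrine\<close>

context primary_doctrine
begin

lemma fib_partial_order: "A \<in> obj (base P) \<Longrightarrow> partial_order (fib P A)"
  by (intro lower_semilattice.axioms(1) inf_semilattice.axioms(1) fib_inf_semilattice)

lemma is_left_adjoint_iff:
  assumes "f \<in> arr (base P)"
  shows "is_left_adjoint P f e \<longleftrightarrow>
    e \<in> carrier (fib P (src (base P) f)) \<rightarrow> carrier (fib P (tgt (base P) f)) \<and>
    (\<forall>\<alpha>\<in>carrier (fib P (src (base P) f)). \<forall>\<beta>\<in>carrier (fib P (tgt (base P) f)).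
      e \<alpha> \<sqsubseteq>\<^bsub>fib P (tgt (base P) f)\<^esub> \<beta> \<longleftrightarrow> \<alpha> \<sqsubseteq>\<^bsub>fib P (src (base P) f)\<^esub> reidx P f \<beta>)"
  using assms
  by (auto simp: is_left_adjoint_def galois_connection_def galois_connection_axioms_def
      connection_def base.src_obj base.tgt_obj fib_partial_order intro: reidx_closed)

text \<open>The values of a left adjoint may be chosen one by one.\<close>

lemma left_adjoint_if_pointwise:
  assumes f: "f \<in> arr (base P)"
    and ex: "\<And>\<alpha>. \<alpha> \<in> carrier (fib P (src (base P) f)) \<Longrightarrow>
      \<exists>\<gamma>\<in>carrier (fib P (tgt (base P) f)). \<forall>\<beta>\<in>carrier (fib P (tgt (base P) f)).
        \<gamma> \<sqsubseteq>\<^bsub>fib P (tgt (base P) f)\<^esub> \<beta> \<longleftrightarrow> \<alpha> \<sqsubseteq>\<^bsub>fib P (src (base P) f)\<^esub> reidx P f \<beta>"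
  shows "\<exists>e. is_left_adjoint P f e"
proof -
  obtain e where "\<And>\<alpha>. \<alpha> \<in> carrier (fib P (src (base P) f)) \<Longrightarrow>
      e \<alpha> \<in> carrier (fib P (tgt (base P) f)) \<and> (\<forall>\<beta>\<in>carrier (fib P (tgt (base P) f)).
        e \<alpha> \<sqsubseteq>\<^bsub>fib P (tgt (base P) f)\<^esub> \<beta> \<longleftrightarrow> \<alpha> \<sqsubseteq>\<^bsub>fib P (src (base P) f)\<^esub> reidx P f \<beta>)"
    using ex by metis
  then have "is_left_adjoint P f e"
    using f by (auto simp: is_left_adjoint_iff)
  then show ?thesis
    by blast
qed

text \<open>The definite description is meaningful because a left adjoint into a partial order is unique on
  its carrier and extensionality fixes it elsewhere.\<close>

lemma ex_is_left_adjoint: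
  assumes f: "f \<in> arr (base P)" and e: "\<exists>e. is_left_adjoint P f e"
  shows "is_left_adjoint P f (ex P f)"
proof -
  interpret T: partial_order "fib P (tgt (base P) f)"
    using f by (simp add: base.tgt_obj fib_partial_order)
  let ?S = "carrier (fib P (src (base P) f))"
  obtain e where e: "is_left_adjoint P f e"
    using e by blast
  have "restrict e ?S \<in> extensional ?S \<and> is_left_adjoint P f (restrict e ?S)"
    using e f by (auto simp: is_left_adjoint_iff)
  moreover have "e1 = e2" if e12: "e1 \<in> extensional ?S \<and> is_left_adjoint P f e1"
    "e2 \<in> extensional ?S \<and> is_left_adjoint P f e2" for e1 e2
  proof (rule extensionalityI)
    fix x assume "x \<in> ?S"
    then show "e1 x = e2 x"
      using e12 f by (intro T.eq_if_same_upper) (auto simp: is_left_adjoint_iff)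
  qed (use e12 in auto)
  ultimately have "\<exists>!e. e \<in> extensional ?S \<and> is_left_adjoint P f e"
    by blast
  then show ?thesis
    unfolding ex_def by (rule theI'[THEN conjunct2])
qed

lemma exc_left_adjoint:
  assumes f: "projection (base P) f" and h: "(h, \<alpha>) \<in> ext_pairs P (src (base P) f)"
    and Y: "Y \<in> carrier (fib (exc P) (tgt (base P) f))"
  shows "ext_class P (f \<odot> h, \<alpha>) \<sqsubseteq>\<^bsub>fib (exc P) (tgt (base P) f)\<^esub> Y \<longleftrightarrow>
    ext_class P (h, \<alpha>) \<sqsubseteq>\<^bsub>fib (exc P) (src (base P) f)\<^esub> reidx (exc P) f Y"
proof -
  obtain y where y: "y \<in> ext_pairs P (tgt (base P) f)" "Y = ext_class P y"
    using Y by (rule exc_carrierE)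
  have f': "f \<in> arr (base P)" and h': "h \<in> arr (base P)" "tgt (base P) h = src (base P) f"
    using f h by (auto simp: ext_pairs_def)
  show ?thesis
    using ext_class_le_iff[OF ext_pairs_after[OF f h] y(1)] exc_le_reidx_iff[OF f' h y(1)]
      ext_le_after_iff_over[OF f' h'] y(2) by simp
qed

lemma exc_left_adjoint_exists:
  assumes f: "projection (base P) f"
  shows "\<exists>e. is_left_adjoint (exc P) f e"
proof -
  interpret E: primary_doctrine "exc P"
    by (rule exc_primary)
  show ?thesis
  proof (rule E.left_adjoint_if_pointwise)
    fix X assume "X \<in> carrier (fib (exc P) (src (base (exc P)) f))"
    then obtain h \<alpha> where h: "(h, \<alpha>) \<in> ext_pairs P (src (base P) f)" "X = ext_class P (h, \<alpha>)"
      by (metis exc_base exc_carrierE surj_pair)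
    show "\<exists>Z\<in>carrier (fib (exc P) (tgt (base (exc P)) f)).
        \<forall>Y\<in>carrier (fib (exc P) (tgt (base (exc P)) f)).
          Z \<sqsubseteq>\<^bsub>fib (exc P) (tgt (base (exc P)) f)\<^esub> Y \<longleftrightarrow>
          X \<sqsubseteq>\<^bsub>fib (exc P) (src (base (exc P)) f)\<^esub> reidx (exc P) f Y"
      using ext_class_closed[OF ext_pairs_after[OF f h(1)]] exc_left_adjoint[OF f h(1)] h(2)
      by auto
  qed (use f in simp)
qed

lemma exc_ex:
  assumes f: "projection (base P) f" and h: "(h, \<alpha>) \<in> ext_pairs P (src (base P) f)"
  shows "ex (exc P) f (ext_class P (h, \<alpha>)) = ext_class P (f \<odot> h, \<alpha>)"
proof -
  interpret E: primary_doctrine "exc P"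
    by (rule exc_primary)
  interpret T: partial_order "fib (exc P) (tgt (base P) f)"
    by (rule exc_partial_order)
  have "is_left_adjoint (exc P) f (ex (exc P) f)"
    using f exc_left_adjoint_exists by (intro E.ex_is_left_adjoint) auto
  then show ?thesis
    using E.is_left_adjoint_iff[of f] exc_left_adjoint[OF f h] f ext_class_closed[OF h]
      ext_class_closed[OF ext_pairs_after[OF f h]]
    by (intro T.eq_if_same_upper) auto
qed

text \<open>On representatives both laws become equalities of pairs. For Beck-Chevalley, the two sides reindex the
  same pair, once in two steps and once along the pasted pullback. For Frobenius, the meet under the
  quantifier is formed over an iterated pullback, whose outer square is the pullback that forms the
  meet on the right.\<close>

lemma exc_existential: "existential_doctrine (exc P)"
proof (rule existential_doctrine.intro[OF exc_primary], rule existential_doctrine_axioms.intro,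
    unfold exc_base)
  show "\<exists>e. is_left_adjoint (exc P) f e" if "projection (base P) f" for f
    using that by (rule exc_left_adjoint_exists)
next
  fix pr pr' f f' X
  assume pr: "projection (base P) pr" and pr': "projection (base P) pr'"
    and pb: "is_pullback (base P) f pr pr' f'" and X: "X \<in> carrier (fib (exc P) (src (base P) pr))"
  note s = base.pullback_simps[OF pb]
  obtain h \<gamma> where h: "(h, \<gamma>) \<in> ext_pairs P (src (base P) pr)" "X = ext_class P (h, \<gamma>)"
    using X by (metis exc_carrierE surj_pair)
  obtain p q where p: "is_pullback (base P) f' h p q"
    "(p, reidx P q \<gamma>) \<in> ext_pairs P (src (base P) f')"
    "reidx (exc P) f' X = ext_class P (p, reidx P q \<gamma>)"
    using exc_reidxE[of f' h \<gamma>] h s by metis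
  have "ex (exc P) pr' (reidx (exc P) f' X) = ext_class P (pr' \<odot> p, reidx P q \<gamma>)"
    using exc_ex[OF pr'] p s by simp
  also have "\<dots> = reidx (exc P) f (ext_class P (pr \<odot> h, \<gamma>))"
    using exc_reidx[OF base.pullback_paste[OF pb p(1)]] ext_pairs_after[OF pr h(1)] s by simp
  also have "\<dots> = reidx (exc P) f (ex (exc P) pr X)"
    using exc_ex[OF pr h(1)] h(2) by simp
  finally show "ex (exc P) pr' (reidx (exc P) f' X) = reidx (exc P) f (ex (exc P) pr X)" .
next
  fix pr X Y
  assume pr: "projection (base P) pr" and X: "X \<in> carrier (fib (exc P) (tgt (base P) pr))"
    and Y: "Y \<in> carrier (fib (exc P) (src (base P) pr))"
  obtain a \<alpha> where a: "(a, \<alpha>) \<in> ext_pairs P (tgt (base P) pr)" "X = ext_class P (a, \<alpha>)"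
    using X by (metis exc_carrierE surj_pair)
  obtain h \<beta> where h: "(h, \<beta>) \<in> ext_pairs P (src (base P) pr)" "Y = ext_class P (h, \<beta>)"
    using Y by (metis exc_carrierE surj_pair)
  obtain p q where p: "is_pullback (base P) pr a p q"
    "(p, reidx P q \<alpha>) \<in> ext_pairs P (src (base P) pr)"
    "reidx (exc P) pr X = ext_class P (p, reidx P q \<alpha>)"
    using exc_reidxE[of pr a \<alpha>] a pr by (metis base.projection_arr)
  obtain r t where r: "is_pullback (base P) p h r t"
    using base.pullback_exists[of h p] p(2) h(1) by (auto simp: ext_pairs_def)
  note s = base.pullback_simps[OF p(1)] base.pullback_simps[OF r]
  have \<alpha>: "\<alpha> \<in> carrier (fib P (src (base P) a))"
    using a by (simp add: ext_pairs_def)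
  have paste: "is_pullback (base P) a (pr \<odot> h) (q \<odot> r) t"
    using base.pullback_paste[OF base.pullback_sym[OF p(1)] r] .
  have legs: "pr \<odot> (p \<odot> r) = a \<odot> (q \<odot> r)"
    using base.assoc[of r p pr] base.assoc[of r q a] s by simp
  have "ex (exc P) pr (reidx (exc P) pr X \<sqinter>\<^bsub>fib (exc P) (src (base P) pr)\<^esub> Y)
      = ex (exc P) pr (ext_class P (p \<odot> r,
          reidx P r (reidx P q \<alpha>) \<sqinter>\<^bsub>fib P (src (base P) r)\<^esub> reidx P t \<beta>))"
    using exc_meet[OF r p(2) h(1)] p(3) h(2) by simp
  also have "\<dots> = ext_class P (pr \<odot> (p \<odot> r),
          reidx P r (reidx P q \<alpha>) \<sqinter>\<^bsub>fib P (src (base P) r)\<^esub> reidx P t \<beta>)"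
    using exc_ex[OF pr ext_pairs_meet[OF r p(2) h(1)]] .
  also have "\<dots> = ext_class P (a \<odot> (q \<odot> r),
          reidx P (q \<odot> r) \<alpha> \<sqinter>\<^bsub>fib P (src (base P) (q \<odot> r))\<^esub> reidx P t \<beta>)"
    using legs reidx_after[of r q \<alpha>] base.cmp_simps[of r q] s \<alpha> by simp
  also have "\<dots> = X \<sqinter>\<^bsub>fib (exc P) (tgt (base P) pr)\<^esub> ext_class P (pr \<odot> h, \<beta>)"
    using exc_meet[OF paste a(1) ext_pairs_after[OF pr h(1)]] a(2) by simp
  also have "\<dots> = X \<sqinter>\<^bsub>fib (exc P) (tgt (base P) pr)\<^esub> ex (exc P) pr Y"
    using exc_ex[OF pr h(1)] h(2) by simp
  finally show "ex (exc P) pr (reidx (exc P) pr X \<sqinter>\<^bsub>fib (exc P) (src (base P) pr)\<^esub> Y)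
    = X \<sqinter>\<^bsub>fib (exc P) (tgt (base P) pr)\<^esub> ex (exc P) pr Y" .
qed

end

section \<open>Existential quantification as a map out of the completion\<close>

context existential_doctrine
begin

lemma ex_closed:
  "\<lbrakk>projection (base P) f; tgt (base P) f = A; \<alpha> \<in> carrier (fib P (src (base P) f))\<rbrakk>
    \<Longrightarrow> ex P f \<alpha> \<in> carrier (fib P A)"
  using ex_is_left_adjoint[OF base.projection_arr left_adjoint_exists, of f]
  by (auto simp: is_left_adjoint_iff)

lemma ex_le_iff:
  "\<lbrakk>projection (base P) f; \<alpha> \<in> carrier (fib P (src (base P) f)); \<beta> \<in> carrier (fib P (tgt (base P) f))\<rbrakk>
    \<Longrightarrow> ex P f \<alpha> \<sqsubseteq>\<^bsub>fib P (tgt (base P) f)\<^esub> \<beta>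
      \<longleftrightarrow> \<alpha> \<sqsubseteq>\<^bsub>fib P (src (base P) f)\<^esub> reidx P f \<beta>"
  using ex_is_left_adjoint[OF base.projection_arr left_adjoint_exists, of f]
  by (auto simp: is_left_adjoint_iff)

text \<open>Left adjoints compose, since reindexing does.\<close>

lemma ex_cmp:
  assumes f: "projection (base P) f" and g: "projection (base P) g"
    and fg: "tgt (base P) g = src (base P) f" and \<alpha>: "\<alpha> \<in> carrier (fib P (src (base P) g))"
  shows "ex P (f \<odot> g) \<alpha> = ex P f (ex P g \<alpha>)"
proof -
  have pfg: "projection (base P) (f \<odot> g)"
    using f g fg by (rule base.projection_cmp)
  interpret T: partial_order "fib P (tgt (base P) f)"
    using f by (simp add: base.tgt_obj fib_partial_order)
  have g\<alpha>: "ex P g \<alpha> \<in> carrier (fib P (src (base P) f))"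
    using g fg \<alpha> by (rule ex_closed)
  show ?thesis
  proof (rule T.eq_if_same_upper)
    fix \<beta> assume \<beta>: "\<beta> \<in> carrier (fib P (tgt (base P) f))"
    then have f\<beta>: "reidx P f \<beta> \<in> carrier (fib P (src (base P) f))"
      using f by (auto intro: reidx_closed)
    show "ex P (f \<odot> g) \<alpha> \<sqsubseteq>\<^bsub>fib P (tgt (base P) f)\<^esub> \<beta>
      \<longleftrightarrow> ex P f (ex P g \<alpha>) \<sqsubseteq>\<^bsub>fib P (tgt (base P) f)\<^esub> \<beta>"
      using ex_le_iff[OF pfg, of \<alpha> \<beta>] ex_le_iff[OF f g\<alpha> \<beta>] ex_le_iff[OF g \<alpha>, of "reidx P f \<beta>"]
        reidx_after[of g f \<beta>] f g fg \<alpha> \<beta> f\<beta> by simp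
  qed (use f g fg \<alpha> g\<alpha> pfg in \<open>auto intro: ex_closed\<close>)
qed

lemma ex_ident:
  assumes A: "A \<in> obj (base P)" and \<alpha>: "\<alpha> \<in> carrier (fib P A)"
  shows "ex P (ident (base P) A) \<alpha> = \<alpha>"
proof -
  interpret T: partial_order "fib P A"
    using A by (rule fib_partial_order)
  have p: "projection (base P) (ident (base P) A)"
    using A by (rule base.projection_ident)
  show ?thesis
  proof (rule T.eq_if_same_upper)
    show "ex P (ident (base P) A) \<alpha> \<sqsubseteq>\<^bsub>fib P A\<^esub> \<beta> \<longleftrightarrow> \<alpha> \<sqsubseteq>\<^bsub>fib P A\<^esub> \<beta>"
      if "\<beta> \<in> carrier (fib P A)" for \<beta>
      using ex_le_iff[OF p, of \<alpha> \<beta>] that A \<alpha> by (simp add: reidx_ident)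
    show "ex P (ident (base P) A) \<alpha> \<in> carrier (fib P A)"
      using p A \<alpha> by (intro ex_closed) auto
  qed fact
qed

text \<open>With \<open>h = f \<odot> w\<close> and the unit of the adjunction for \<open>f\<close>,
  \<open>\<alpha> \<sqsubseteq> P\<^bsub>w\<^esub> \<gamma> \<sqsubseteq> P\<^bsub>w\<^esub> (P\<^bsub>f\<^esub> (\<exists>\<^bsub>f\<^esub> \<gamma>)) = P\<^bsub>h\<^esub> (\<exists>\<^bsub>f\<^esub> \<gamma>)\<close>; transposing along \<open>h\<close> gives
  the claim. In particular \<open>\<exists>\<close> is well defined on classes.\<close>

lemma ex_mono_ext_le:
  assumes x: "(h, \<alpha>) \<in> ext_pairs P A" and y: "(f, \<gamma>) \<in> ext_pairs P A"
    and le: "ext_le P (h, \<alpha>) (f, \<gamma>)"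
  shows "ex P h \<alpha> \<sqsubseteq>\<^bsub>fib P A\<^esub> ex P f \<gamma>"
proof -
  have h: "projection (base P) h" "tgt (base P) h = A" "\<alpha> \<in> carrier (fib P (src (base P) h))"
    and f: "projection (base P) f" "tgt (base P) f = A" "\<gamma> \<in> carrier (fib P (src (base P) f))"
    using x y by (auto simp: ext_pairs_def)
  obtain w where w: "w \<in> arr (base P)" "src (base P) w = src (base P) h"
    "tgt (base P) w = src (base P) f" "f \<odot> w = h" "\<alpha> \<sqsubseteq>\<^bsub>fib P (src (base P) h)\<^esub> reidx P w \<gamma>"
    using le by (auto simp: ext_le_def Hom_def)
  interpret H: partial_order "fib P (src (base P) h)"
    using h by (simp add: base.src_obj fib_partial_order)
  interpret F: partial_order "fib P (src (base P) f)"
    using f by (simp add: base.src_obj fib_partial_order)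
  have e: "ex P f \<gamma> \<in> carrier (fib P A)"
    using f by (intro ex_closed)
  then have fe: "reidx P f (ex P f \<gamma>) \<in> carrier (fib P (src (base P) f))"
    using f by (auto intro: reidx_closed)
  interpret T: partial_order "fib P A"
    using x ext_pairs_obj fib_partial_order by blast
  have "\<gamma> \<sqsubseteq>\<^bsub>fib P (src (base P) f)\<^esub> reidx P f (ex P f \<gamma>)"
    using ex_le_iff[OF f(1) f(3), of "ex P f \<gamma>"] e f T.le_refl by simp
  then have "reidx P w \<gamma> \<sqsubseteq>\<^bsub>fib P (src (base P) h)\<^esub> reidx P w (reidx P f (ex P f \<gamma>))"
    using reidx_mono[of w \<gamma> "reidx P f (ex P f \<gamma>)"] w f fe by simp
  also have "reidx P w (reidx P f (ex P f \<gamma>)) = reidx P h (ex P f \<gamma>)"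
    using reidx_after[of w f "ex P f \<gamma>"] w f e by simp
  finally have "reidx P w \<gamma> \<sqsubseteq>\<^bsub>fib P (src (base P) h)\<^esub> reidx P h (ex P f \<gamma>)" .
  then have "\<alpha> \<sqsubseteq>\<^bsub>fib P (src (base P) h)\<^esub> reidx P h (ex P f \<gamma>)"
    using H.le_trans[OF w(5)] h f w e by (simp add: reidx_closed)
  then show ?thesis
    using ex_le_iff[OF h(1) h(3), of "ex P f \<gamma>"] h e by simp
qed

lemma zeta_ext_class:
  assumes x: "(f, \<alpha>) \<in> ext_pairs P A"
  shows "zeta P A (ext_class P (f, \<alpha>)) = ex P f \<alpha>"
proof -
  have A: "A \<in> obj (base P)"
    using x by (rule ext_pairs_obj)
  interpret T: partial_order "fib P A"
    using A by (rule fib_partial_order)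
  have "ex P g \<beta> = ex P f \<alpha>" if "(g, \<beta>) \<in> ext_class P (f, \<alpha>)" for g \<beta>
    using ext_class_memD[OF that x] x
    by (intro T.le_antisym ex_mono_ext_le) (auto simp: ext_pairs_def intro: ex_closed)
  then have "{ex P g \<beta> | g \<beta>. (g, \<beta>) \<in> ext_class P (f, \<alpha>)} = {ex P f \<alpha>}"
    using ext_class_self[OF x] by blast
  then show ?thesis
    using A ext_class_closed[OF x] by (simp add: zeta_def)
qed

lemma zeta_reidx:
  assumes f: "f \<in> arr (base P)" and X: "X \<in> carrier (fib (exc P) (tgt (base P) f))"
  shows "zeta P (src (base P) f) (reidx (exc P) f X) = reidx P f (zeta P (tgt (base P) f) X)"
proof -
  obtain g \<beta> where g: "(g, \<beta>) \<in> ext_pairs P (tgt (base P) f)" "X = ext_class P (g, \<beta>)"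
    using X by (metis exc_carrierE surj_pair)
  obtain p q where p: "is_pullback (base P) f g p q"
    "(p, reidx P q \<beta>) \<in> ext_pairs P (src (base P) f)"
    "reidx (exc P) f X = ext_class P (p, reidx P q \<beta>)"
    using exc_reidxE[OF f g(1)] g(2) by metis
  have "ex P p (reidx P q \<beta>) = reidx P f (ex P g \<beta>)"
    using p g by (intro beck_chevalley) (auto simp: ext_pairs_def)
  then show ?thesis
    using p g by (simp add: zeta_ext_class)
qed

text \<open>The computation is
  \<open>\<exists>\<^bsub>g\<^esub> \<exists>\<^bsub>p\<^esub> (P\<^bsub>p\<^esub> \<alpha> \<sqinter> P\<^bsub>q\<^esub> \<beta>) = \<exists>\<^bsub>g\<^esub> (\<alpha> \<sqinter> \<exists>\<^bsub>p\<^esub> (P\<^bsub>q\<^esub> \<beta>)) = \<exists>\<^bsub>g\<^esub> (\<alpha> \<sqinter> P\<^bsub>g\<^esub> (\<exists>\<^bsub>h\<^esub> \<beta>)) = \<exists>\<^bsub>g\<^esub> \<alpha> \<sqinter> \<exists>\<^bsub>h\<^esub> \<beta>\<close>,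
  by Frobenius for \<open>p\<close>, Beck-Chevalley, and Frobenius for \<open>g\<close>.\<close>

lemma ex_meet_pullback:
  assumes pb: "is_pullback (base P) g h p q"
    and g: "(g, \<alpha>) \<in> ext_pairs P A" and h: "(h, \<beta>) \<in> ext_pairs P A"
  shows "ex P (g \<odot> p) (reidx P p \<alpha> \<sqinter>\<^bsub>fib P (src (base P) p)\<^esub> reidx P q \<beta>)
    = ex P g \<alpha> \<sqinter>\<^bsub>fib P A\<^esub> ex P h \<beta>"
proof -
  note s = base.pullback_simps[OF pb]
  have g': "projection (base P) g" "tgt (base P) g = A" "\<alpha> \<in> carrier (fib P (src (base P) g))"
    and h': "projection (base P) h" "tgt (base P) h = A" "\<beta> \<in> carrier (fib P (src (base P) h))"
    using g h by (auto simp: ext_pairs_def)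
  have p: "projection (base P) p"
    using pb h'(1) by (rule base.pullback_projection)
  interpret S: inf_semilattice "fib P (src (base P) p)"
    using s base.src_obj fib_inf_semilattice by blast
  have q\<beta>: "reidx P q \<beta> \<in> carrier (fib P (src (base P) p))"
    using s h' by (intro reidx_closed) auto
  have h\<beta>: "ex P h \<beta> \<in> carrier (fib P A)"
    using h' by (intro ex_closed) auto
  have "ex P (g \<odot> p) (reidx P p \<alpha> \<sqinter>\<^bsub>fib P (src (base P) p)\<^esub> reidx P q \<beta>)
      = ex P g (ex P p (reidx P p \<alpha> \<sqinter>\<^bsub>fib P (src (base P) p)\<^esub> reidx P q \<beta>))"
    using s p g' h' by (intro ex_cmp S.meet_closed reidx_closed) auto
  also have "\<dots> = ex P g (\<alpha> \<sqinter>\<^bsub>fib P (src (base P) g)\<^esub> ex P p (reidx P q \<beta>))"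
    using frobenius[OF p, of \<alpha> "reidx P q \<beta>"] s g' q\<beta> by simp
  also have "\<dots> = ex P g (\<alpha> \<sqinter>\<^bsub>fib P (src (base P) g)\<^esub> reidx P g (ex P h \<beta>))"
    using beck_chevalley[OF h'(1) p pb h'(3)] by simp
  also have "\<dots> = ex P g (reidx P g (ex P h \<beta>) \<sqinter>\<^bsub>fib P (src (base P) g)\<^esub> \<alpha>)"
    by (simp add: meet_comm)
  also have "\<dots> = ex P h \<beta> \<sqinter>\<^bsub>fib P A\<^esub> ex P g \<alpha>"
    using frobenius[OF g'(1), of "ex P h \<beta>" \<alpha>] g' h\<beta> by simp
  finally show ?thesis
    by (simp add: meet_comm)
qed

lemma zeta_meet_map:
  assumes A: "A \<in> obj (base P)"
  shows "meet_map (fib (exc P) A) (fib P A) (zeta P A)"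
proof -
  interpret A: inf_semilattice "fib P A"
    using A by (rule fib_inf_semilattice)
  have "zeta P A X \<in> carrier (fib P A)" if X: "X \<in> carrier (fib (exc P) A)" for X
  proof -
    obtain f \<alpha> where f: "(f, \<alpha>) \<in> ext_pairs P A" "X = ext_class P (f, \<alpha>)"
      using X by (metis exc_carrierE surj_pair)
    then show ?thesis
      by (auto simp: zeta_ext_class ext_pairs_def intro: ex_closed)
  qed
  moreover have "zeta P A \<top>\<^bsub>fib (exc P) A\<^esub> = \<top>\<^bsub>fib P A\<^esub>"
    using A zeta_ext_class[OF ext_pairs_ident[OF A]] by (simp add: exc_top ex_ident)
  moreover have "zeta P A (X \<sqinter>\<^bsub>fib (exc P) A\<^esub> Y) = zeta P A X \<sqinter>\<^bsub>fib P A\<^esub> zeta P A Y"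
    if XY: "X \<in> carrier (fib (exc P) A)" "Y \<in> carrier (fib (exc P) A)" for X Y
  proof -
    obtain g \<alpha> where g: "(g, \<alpha>) \<in> ext_pairs P A" "X = ext_class P (g, \<alpha>)"
      using XY(1) by (metis exc_carrierE surj_pair)
    obtain h \<beta> where h: "(h, \<beta>) \<in> ext_pairs P A" "Y = ext_class P (h, \<beta>)"
      using XY(2) by (metis exc_carrierE surj_pair)
    obtain p q where pb: "is_pullback (base P) g h p q"
      using base.pullback_exists[of h g] g h by (auto simp: ext_pairs_def)
    show ?thesis
      using exc_meet[OF pb g(1) h(1)] zeta_ext_class[OF ext_pairs_meet[OF pb g(1) h(1)]]
        ex_meet_pullback[OF pb g(1) h(1)] zeta_ext_class[OF g(1)] zeta_ext_class[OF h(1)] g(2) h(2)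
      by simp
  qed
  ultimately show ?thesis
    by (auto simp: meet_map_def)
qed

text \<open>On a representative \<open>(h, \<alpha>)\<close> both sides are \<open>\<exists>\<^bsub>g\<^esub> (\<exists>\<^bsub>h\<^esub> \<alpha>)\<close>.\<close>

lemma zeta_ex:
  assumes g: "projection (base P) g" and X: "X \<in> carrier (fib (exc P) (src (base P) g))"
  shows "zeta P (tgt (base P) g) (ex (exc P) g X) = ex P g (zeta P (src (base P) g) X)"
proof -
  obtain h \<alpha> where h: "(h, \<alpha>) \<in> ext_pairs P (src (base P) g)" "X = ext_class P (h, \<alpha>)"
    using X by (metis exc_carrierE surj_pair)
  then show ?thesis
    using exc_ex[OF g h(1)] zeta_ext_class[OF ext_pairs_after[OF g h(1)]] zeta_ext_class[OF h(1)]
      ex_cmp[OF g] by (simp add: ext_pairs_def)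
qed

lemma zeta_cell_pd_cell: "pd_cell (exc P) P (zeta_cell P)"
proof -
  have arr: "p \<in> arr (base P) \<and> q \<in> arr (base P)" if "is_product (base P) p q" for p q
    using that by (simp add: is_product_def)
  have obj: "t \<in> obj (base P)" if "is_terminal (base P) t" for t
    using that by (simp add: is_terminal_def)
  have "fp_functor (base P) (base P) (id_ftor (base P))"
    by unfold_locales (auto simp: id_ftor_def Hom_def base.src_obj base.tgt_obj dest: arr obj)
  then show ?thesis
    unfolding pd_cell_def zeta_cell_def
    using exc_primary primary_doctrine_axioms
    by (auto simp: zeta_meet_map Hom_def zeta_reidx id_ftor_def) (auto simp: zeta_def)
qed

lemma zeta_cell_ed_cell: "ed_cell (exc P) P (zeta_cell P)"
  using zeta_cell_pd_cell exc_existential existential_doctrine_axioms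
  by (auto simp: ed_cell_def zeta_cell_def zeta_ex id_ftor_def)

end

section \<open>The algebra laws\<close>

text \<open>A functor that preserves products preserves projections, and it carries a witness \<open>w\<close> for the
  order to the witness \<open>F w\<close>; so the action of a 1-cell on pairs respects equivalence.\<close>

lemma exc_cell_ext_class:
  assumes c: "pd_cell P R (F, b)" and x: "(g, \<alpha>) \<in> ext_pairs P A"
  shows "snd (exc_cell P R (F, b)) A (ext_class P (g, \<alpha>))
    = ext_class R (on_arr F g, b (src (base P) g) \<alpha>)"
proof -
  interpret P: primary_doctrine P
    using c by (simp add: pd_cell_def)
  interpret R: primary_doctrine R
    using c by (simp add: pd_cell_def)
  interpret F: fp_functor "base P" "base R" F
    using c by (simp add: pd_cell_def)
  have map: "meet_map (fib P B) (fib R (on_obj F B)) (b B)" if "B \<in> obj (base P)" for B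
    using c that by (simp add: pd_cell_def)
  have nat: "b (src (base P) f) (reidx P f \<beta>) = reidx R (on_arr F f) (b (tgt (base P) f) \<beta>)"
    if "f \<in> arr (base P)" "\<beta> \<in> carrier (fib P (tgt (base P) f))" for f \<beta>
    using c that P.base.arr_in_Hom P.base.src_obj P.base.tgt_obj unfolding pd_cell_def by blast
  have F: "on_arr F f \<in> arr (base R)" "src (base R) (on_arr F f) = on_obj F (src (base P) f)"
    "tgt (base R) (on_arr F f) = on_obj F (tgt (base P) f)" if "f \<in> arr (base P)" for f
    using F.on_arr_hom[OF P.base.arr_in_Hom[OF that]] by (auto simp: Hom_def)
  have pair: "(on_arr F g, b (src (base P) g) \<alpha>) \<in> ext_pairs R (on_obj F A)"
    if "(g, \<alpha>) \<in> ext_pairs P A" for g \<alpha>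
  proof -
    have g: "projection (base P) g" "tgt (base P) g = A" "\<alpha> \<in> carrier (fib P (src (base P) g))"
      "g \<in> arr (base P)"
      using that by (auto simp: ext_pairs_def)
    have "projection (base R) (on_arr F g)"
      using g(1) F.preserves_product unfolding projection_def by blast
    moreover have "b (src (base P) g) \<alpha> \<in> carrier (fib R (on_obj F (src (base P) g)))"
      using map[of "src (base P) g"] g P.base.src_obj by (auto simp: meet_map_def)
    ultimately show ?thesis
      using g F by (simp add: ext_pairs_def)
  qed
  have le: "ext_le R (on_arr F h, b (src (base P) h) \<beta>) (on_arr F g, b (src (base P) g) \<alpha>)"
    if h: "(h, \<beta>) \<in> ext_pairs P A" and g: "(g, \<alpha>) \<in> ext_pairs P A"
      and le: "ext_le P (h, \<beta>) (g, \<alpha>)" for h \<beta> g \<alpha>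
  proof -
    have h': "h \<in> arr (base P)" "\<beta> \<in> carrier (fib P (src (base P) h))"
      and g': "g \<in> arr (base P)" "\<alpha> \<in> carrier (fib P (src (base P) g))"
      using h g by (auto simp: ext_pairs_def)
    obtain w where w: "w \<in> arr (base P)" "src (base P) w = src (base P) h"
      "tgt (base P) w = src (base P) g" "g \<cdot>\<^bsub>base P\<^esub> w = h"
      "\<beta> \<sqsubseteq>\<^bsub>fib P (src (base P) h)\<^esub> reidx P w \<alpha>"
      using le by (auto simp: ext_le_def Hom_def)
    have "on_arr F g \<cdot>\<^bsub>base R\<^esub> on_arr F w = on_arr F h"
      using F.preserves_cmp[of w "src (base P) w" "src (base P) g" g "tgt (base P) g"] w g'
      by (simp add: Hom_def)
    moreover have "b (src (base P) h) \<beta> \<sqsubseteq>\<^bsub>fib R (on_obj F (src (base P) h))\<^esub>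
        b (src (base P) h) (reidx P w \<alpha>)"
      using h' g' w P.base.src_obj[of h] F.on_obj_closed[of "src (base P) h"] P.reidx_closed[of w]
      by (intro meet_map_mono[OF P.fib_inf_semilattice R.fib_inf_semilattice map]) simp_all
    then have "b (src (base P) h) \<beta> \<sqsubseteq>\<^bsub>fib R (on_obj F (src (base P) h))\<^esub>
        reidx R (on_arr F w) (b (src (base P) g) \<alpha>)"
      using nat[of w \<alpha>] w g' by simp
    ultimately show ?thesis
      using w(2,3) F[OF w(1)] F[OF g'(1)] F[OF h'(1)] unfolding ext_le_def prod.case
      by (intro bexI[of _ "on_arr F w"]) (simp_all add: Hom_def)
  qed
  have "ext_class R (on_arr F h, b (src (base P) h) \<beta>)
      = ext_class R (on_arr F g, b (src (base P) g) \<alpha>)"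
    if "(h, \<beta>) \<in> ext_class P (g, \<alpha>)" for h \<beta>
    using P.ext_class_memD[OF that x] R.ext_class_eq_iff[OF pair pair] le x by blast
  then have "{ext_class R (on_arr F h, b (src (base P) h) \<beta>) | h \<beta>. (h, \<beta>) \<in> ext_class P (g, \<alpha>)}
      \<subseteq> {ext_class R (on_arr F g, b (src (base P) g) \<alpha>)}" (is "?S \<subseteq> _")
    by clarsimp
  moreover have "ext_class R (on_arr F g, b (src (base P) g) \<alpha>) \<in> ?S"
    using P.ext_class_self[OF x] by blast
  ultimately have "?S = {ext_class R (on_arr F g, b (src (base P) g) \<alpha>)}"
    by blast
  then show ?thesis
    using P.ext_pairs_obj[OF x] P.ext_class_closed[OF x] by (simp add: exc_cell_def)
qed

context existential_doctrine
begin

text \<open>On a representative \<open>(g, Y)\<close> the left-hand side is \<open>\<exists>\<^bsub>g\<^esub> (\<zeta> Y)\<close> and the right-hand side is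
  \<open>\<zeta> (\<exists>\<^sup>e\<^bsub>g\<^esub> Y)\<close>. So the associativity law says exactly that \<open>\<zeta>\<close> commutes with quantification.\<close>

lemma zeta_associative:
  assumes X: "X \<in> carrier (fib (exc (exc P)) A)"
  shows "zeta P A (snd (exc_cell (exc P) P (zeta_cell P)) A X) = zeta P A (zeta (exc P) A X)"
proof -
  interpret E: existential_doctrine "exc P"
    by (rule exc_existential)
  obtain g Y where x: "(g, Y) \<in> ext_pairs (exc P) A" "X = ext_class (exc P) (g, Y)"
    using X by (metis E.exc_carrierE surj_pair)
  have g: "projection (base P) g" "tgt (base P) g = A" "Y \<in> carrier (fib (exc P) (src (base P) g))"
    using x(1) by (auto simp: ext_pairs_def)
  have "zeta P (src (base P) g) Y \<in> carrier (fib P (src (base P) g))"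
    using zeta_meet_map[of "src (base P) g"] g base.src_obj by (auto simp: meet_map_def)
  then have pair: "(g, zeta P (src (base P) g) Y) \<in> ext_pairs P A"
    using g by (simp add: ext_pairs_def)
  have "zeta P A (snd (exc_cell (exc P) P (zeta_cell P)) A X)
      = zeta P A (ext_class P (g, zeta P (src (base P) g) Y))"
    using exc_cell_ext_class[OF zeta_cell_pd_cell[unfolded zeta_cell_def] x(1)] g x(2)
    by (simp add: zeta_cell_def id_ftor_def)
  also have "\<dots> = ex P g (zeta P (src (base P) g) Y)"
    using pair by (rule zeta_ext_class)
  also have "\<dots> = zeta P A (ex (exc P) g Y)"
    using zeta_ex[OF g(1,3)] g(2) by simp
  also have "\<dots> = zeta P A (zeta (exc P) A X)"
    using E.zeta_ext_class[OF x(1)] x(2) by simp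
  finally show ?thesis .
qed

lemma zeta_unit:
  "\<lbrakk>A \<in> obj (base P); \<alpha> \<in> carrier (fib P A)\<rbrakk>
    \<Longrightarrow> zeta P A (ext_class P (ident (base P) A, \<alpha>)) = \<alpha>"
  using zeta_ext_class[OF ext_pairs_ident] ex_ident by simp

lemma zeta_cell_exc_algebra: "exc_algebra P (zeta_cell P)"
  unfolding exc_algebra_def
proof (intro conjI)
  show "pd_cell (exc P) P (zeta_cell P)"
    by (rule zeta_cell_pd_cell)
  have "compose (carrier (fib (exc (exc P)) A)) (zeta P A)
        (snd (exc_cell (exc P) P (zeta_cell P)) A)
      = compose (carrier (fib (exc (exc P)) A)) (zeta P A) (zeta (exc P) A)" for A
    using zeta_associative by (auto simp: compose_def)
  moreover have "fst (exc_cell (exc P) P (zeta_cell P)) = id_ftor (base P)"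
    by (simp add: exc_cell_def zeta_cell_def)
  ultimately show "comp_cell (exc (exc P)) (zeta_cell P) (exc_cell (exc P) P (zeta_cell P))
    = comp_cell (exc (exc P)) (zeta_cell P) (exc_mult P)"
    by (auto simp: comp_cell_def exc_mult_def zeta_cell_def case_prod_unfold id_ftor_def exc_def
        intro!: restrict_ext)
  show "comp_cell P (zeta_cell P) (exc_unit P) = id_cell P"
    by (auto simp: comp_cell_def exc_unit_def zeta_cell_def id_cell_def comp_ftor_def id_ftor_def
        compose_def zeta_unit fun_eq_iff restrict_def)
qed

end

theorem proposition5p2:
  fixes P :: "('o, 'm, 'a) doctrine"
  assumes "existential_doctrine P"
  shows "ed_cell (exc P) P (zeta_cell P) \<and>
    (\<forall>A\<in>obj (base P). \<forall>f \<alpha>. (f, \<alpha>) \<in> ext_pairs P A \<longrightarrow>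
       zeta P A (ext_class P (f, \<alpha>)) = ex P f \<alpha>) \<and>
    exc_algebra P (zeta_cell P)"
proof -
  interpret existential_doctrine P
    by fact
  show ?thesis
    using zeta_cell_ed_cell zeta_ext_class zeta_cell_exc_algebra by blast
qed

end
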